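(* Consider the problem and the SONATA algorithm described below, with $\{G^k\}$ $B$-strongly connected, each $\mathbf{A}^k$ compliant with $G^k$ and column stochastic, and surrogates satisfying Assumption III.14. Let $\bar{\mathbf{x}}^k=\frac1I\sum_i\mathbf{x}_{(i)}^k$ and $M(\mathbf{x}^k)\triangleq\max\{J(\bar{\mathbf{x}}^k)^2,D(\mathbf{x}^k)^2\}$. Suppose either (a) $\gamma^k\in(0,1]$ with $\lim_k\gamma^k=0$ and $\sum_k\gamma^k=\infty$; or (b) $\gamma^k\equiv\gamma$ constant with $\gamma\in(0,\bar\gamma]$, where $\bar\gamma>0$ is a sufficiently small threshold depending only on the problem data, the network and the weights. Then $\lim_{k\to\infty}M(\mathbf{x}^k)=0$.
   Context: Problem: minimize $V(\mathbf{x})\triangleq F(\mathbf{x})+G(\mathbf{x})$, $F=\sum_{i=1}^If_i$, over $\mathbf{x}\in X$, where $X\subseteq\mathbb{R}^m$ is nonempty closed convex; each $f_i:O\to\mathbb{R}$ is $C^1$ on an open set $O\supseteq X$ with $\nabla f_i$ $L_i$-Lipschitz on $X$; $G:O\to\mathbb{R}$ is convex (possibly nonsmooth); $V$ is bounded below on $X$. Network: digraphs $G^k=(\{1,\dots,I\},E^k)$, $(j,i)\in E^k$ meaning $j$ can send to $i$; $B$-strongly connected: there is an integer $B>0$ with $\bigcup_{t=k}^{k+B-1}E^t$ strongly connected for every $k$. $\mathbf{A}^k=(a_{ij}^k)$ compliant with $G^k$: $a_{ij}^k=0$ if $j\ne i$ and $(j,i)\notin E^k$, $a_{ij}^k\ge\kappa$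 if $(j,i)\in E^k$, $a_{ii}^k\ge\kappa$ for some $\kappa>0$; column stochastic: nonnegative with $\mathbf{1}^T\mathbf{A}^k=\mathbf{1}^T$. Assumption III.14 on $\widetilde f_i:O\times O\to\mathbb{R}$: $\widetilde f_i(\cdot|\mathbf{x})$ is $\tau_i$-strongly convex on $X$ for all $\mathbf{x}\in X$; $\widetilde f_i(\cdot|\mathbf{x})$ is $C^1$ on $O$ with $\nabla\widetilde f_i(\mathbf{x}|\mathbf{x})=\nabla f_i(\mathbf{x})$ for $\mathbf{x}\in X$; $\nabla\widetilde f_i(\mathbf{x}|\cdot)$ is $\widetilde L_i$-Lipschitz on $X$ for all $\mathbf{x}\in X$. SONATA: initialize $\mathbf{x}_{(i)}^0\in X$, $\phi_{(i)}^0=1$, $\mathbf{y}_{(i)}^0=\nabla f_i(\mathbf{x}_{(i)}^0)$; at iteration $k$, each agent $i$ computes $\widetilde{\mathbf{x}}_i^k=\operatorname{argmin}_{\mathbf{x}\in X}\{\widetilde f_i(\mathbf{x}|\mathbf{x}_{(i)}^k)+(I\mathbf{y}_{(i)}^k-\nabla f_i(\mathbf{x}_{(i)}^k))^T(\mathbf{x}-\mathbf{x}_{(i)}^k)+G(\mathbf{x})\}$, $\mathbf{x}_{(i)}^{k+1/2}=\mathbf{x}_{(i)}^k+\gamma^k(\widetilde{\mathbf{x}}_i^k-\mathbf{x}_{(i)}^k)$, then $\phi_{(i)}^{k+1}=\sum_ja_{ij}^k\phi_{(j)}^k$, $\mathbf{x}_{(i)}^{k+1}=\frac{1}{\phi_{(i)}^{k+1}}\sum_ja_{ij}^k\phi_{(j)}^k\mathbf{x}_{(j)}^{k+1/2}$,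 $\mathbf{y}_{(i)}^{k+1}=\frac{1}{\phi_{(i)}^{k+1}}\sum_ja_{ij}^k\phi_{(j)}^k\mathbf{y}_{(j)}^k+\frac{1}{\phi_{(i)}^{k+1}}(\nabla f_i(\mathbf{x}_{(i)}^{k+1})-\nabla f_i(\mathbf{x}_{(i)}^k))$. Merit functions: $J(\bar{\mathbf{x}})\triangleq\big\|\bar{\mathbf{x}}-\operatorname{argmin}_{\mathbf{y}\in X}\{\nabla F(\bar{\mathbf{x}})^T(\mathbf{y}-\bar{\mathbf{x}})+\frac12\|\mathbf{y}-\bar{\mathbf{x}}\|^2+G(\mathbf{y})\}\big\|$ and $D(\mathbf{x}^k)\triangleq\|\mathbf{x}^k-\mathbf{1}_I\otimes\bar{\mathbf{x}}^k\|$, where $\mathbf{x}^k=(\mathbf{x}_{(i)}^k)_{i=1}^I$ stacked. *)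

theory Defs
  imports "HOL-Analysis.Analysis"
begin

text \<open>Continuously differentiable on the open set O with gradient g.\<close>
definition C1_grad_on :: "'a::euclidean_space set \<Rightarrow> ('a \<Rightarrow> real) \<Rightarrow> ('a \<Rightarrow> 'a) \<Rightarrow> bool" where
  "C1_grad_on U f g \<longleftrightarrow>
     (\<forall>x\<in>U. (f has_derivative (\<lambda>h. g x \<bullet> h)) (at x)) \<and> continuous_on U g"

text \<open>tau-strong convexity on a set.\<close>
definition strongly_convex_on :: "real \<Rightarrow> 'a::real_normed_vector set \<Rightarrow> ('a \<Rightarrow> real) \<Rightarrow> bool" where
  "strongly_convex_on tau S h \<longleftrightarrow> tau > 0 \<and>
     (\<forall>x\<in>S. \<forall>y\<in>S. \<forall>t\<in>{0..1}.
        h (t *\<^sub>R x + (1 - t) *\<^sub>R y) \<le> t * h x + (1 - t) * h y - tau / 2 * t * (1 - t) * (norm (x - y))\<^sup>2)"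

text \<open>z is a minimizer of h over S.\<close>
definition minimizer_on :: "'a set \<Rightarrow> ('a \<Rightarrow> real) \<Rightarrow> 'a \<Rightarrow> bool" where
  "minimizer_on S h z \<longleftrightarrow> z \<in> S \<and> (\<forall>w\<in>S. h z \<le> h w)"

text \<open>Digraph on nodes 0..<I, edge (j,i) means j sends to i. Strongly connected.\<close>
definition strongly_connected_on :: "nat \<Rightarrow> (nat \<times> nat) set \<Rightarrow> bool" where
  "strongly_connected_on I E \<longleftrightarrow> (\<forall>i<I. \<forall>j<I. (i, j) \<in> E\<^sup>*)"

definition B_strongly_connected :: "nat \<Rightarrow> (nat \<Rightarrow> (nat \<times> nat) set) \<Rightarrow> nat \<Rightarrow> bool" where
  "B_strongly_connected I E B \<longleftrightarrow> B > 0 \<and>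
     (\<forall>k. strongly_connected_on I (\<Union>t\<in>{k..<k+B}. E t))"

text \<open>Weight matrix a_ij (written A i j) compliant with digraph E, with constant kappa.\<close>
definition compliant :: "nat \<Rightarrow> (nat \<times> nat) set \<Rightarrow> real \<Rightarrow> (nat \<Rightarrow> nat \<Rightarrow> real) \<Rightarrow> bool" where
  "compliant I E kappa A \<longleftrightarrow>
     (\<forall>i<I. \<forall>j<I. (j \<noteq> i \<and> (j, i) \<notin> E \<longrightarrow> A i j = 0) \<and> ((j, i) \<in> E \<longrightarrow> A i j \<ge> kappa)) \<and>
     (\<forall>i<I. A i i \<ge> kappa)"

definition column_stochastic :: "nat \<Rightarrow> (nat \<Rightarrow> nat \<Rightarrow> real) \<Rightarrow> bool" where
  "column_stochastic I A \<longleftrightarrow> (\<forall>i<I. \<forall>j<I. 0 \<le> A i j) \<and> (\<forall>j<I. (\<Sum>i<I. A i j) = 1)"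

text \<open>SONATA iterates: x k i = x_(i)^k, xh k i = x_(i)^(k+1/2), xt k i = tilde x_i^k,
  y k i = y_(i)^k, phi k i = phi_(i)^k; ft i z x = tilde f_i(z | x); gf i = grad f_i.\<close>
definition sonata_run ::
  "nat \<Rightarrow> 'a::euclidean_space set \<Rightarrow> ('a \<Rightarrow> real) \<Rightarrow> (nat \<Rightarrow> 'a \<Rightarrow> 'a) \<Rightarrow> (nat \<Rightarrow> 'a \<Rightarrow> 'a \<Rightarrow> real)
   \<Rightarrow> (nat \<Rightarrow> nat \<Rightarrow> nat \<Rightarrow> real) \<Rightarrow> (nat \<Rightarrow> real)
   \<Rightarrow> (nat \<Rightarrow> nat \<Rightarrow> 'a) \<Rightarrow> (nat \<Rightarrow> nat \<Rightarrow> 'a) \<Rightarrow> (nat \<Rightarrow> nat \<Rightarrow> 'a) \<Rightarrow> (nat \<Rightarrow> nat \<Rightarrow> 'a)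
   \<Rightarrow> (nat \<Rightarrow> nat \<Rightarrow> real) \<Rightarrow> bool" where
  "sonata_run I X G gf ft A \<gamma> x xh xt y phi \<longleftrightarrow>
     (\<forall>i<I. x 0 i \<in> X \<and> phi 0 i = 1 \<and> y 0 i = gf i (x 0 i)) \<and>
     (\<forall>k. \<forall>i<I.
        minimizer_on X
          (\<lambda>z. ft i z (x k i) + (real I *\<^sub>R y k i - gf i (x k i)) \<bullet> (z - x k i) + G z) (xt k i) \<and>
        xh k i = x k i + \<gamma> k *\<^sub>R (xt k i - x k i) \<and>
        phi (Suc k) i = (\<Sum>j<I. A k i j * phi k j) \<and>
        x (Suc k) i = (1 / phi (Suc k) i) *\<^sub>R (\<Sum>j<I. (A k i j * phi k j) *\<^sub>R xh k j) \<and>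
        y (Suc k) i = (1 / phi (Suc k) i) *\<^sub>R (\<Sum>j<I. (A k i j * phi k j) *\<^sub>R y k j)
                      + (1 / phi (Suc k) i) *\<^sub>R (gf i (x (Suc k) i) - gf i (x k i)))"

definition avg :: "nat \<Rightarrow> (nat \<Rightarrow> 'a::real_vector) \<Rightarrow> 'a" where
  "avg I v = (1 / real I) *\<^sub>R (\<Sum>i<I. v i)"

text \<open>The point argmin_{y in X} grad F(xb)^T (y - xb) + 1/2 |y - xb|^2 + G y.\<close>
definition prox_point :: "'a::euclidean_space set \<Rightarrow> ('a \<Rightarrow> real) \<Rightarrow> 'a \<Rightarrow> 'a \<Rightarrow> 'a" where
  "prox_point X G g xb =
     (THE z. minimizer_on X (\<lambda>w. g \<bullet> (w - xb) + 1/2 * (norm (w - xb))\<^sup>2 + G w) z)"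

definition merit_J :: "nat \<Rightarrow> 'a::euclidean_space set \<Rightarrow> ('a \<Rightarrow> real) \<Rightarrow> (nat \<Rightarrow> 'a \<Rightarrow> 'a) \<Rightarrow> 'a \<Rightarrow> real" where
  "merit_J I X G gf xb = norm (xb - prox_point X G (\<Sum>i<I. gf i xb) xb)"

definition merit_D :: "nat \<Rightarrow> (nat \<Rightarrow> 'a::euclidean_space) \<Rightarrow> real" where
  "merit_D I v = sqrt (\<Sum>i<I. (norm (v i - avg I v))\<^sup>2)"

definition merit_M :: "nat \<Rightarrow> 'a::euclidean_space set \<Rightarrow> ('a \<Rightarrow> real) \<Rightarrow> (nat \<Rightarrow> 'a \<Rightarrow> 'a) \<Rightarrow> (nat \<Rightarrow> 'a) \<Rightarrow> real" where
  "merit_M I X G gf v = max ((merit_J I X G gf (avg I v))\<^sup>2) ((merit_D I v)\<^sup>2)"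

end

theory Submission
  imports Defs
begin

text \<open>
  Let \<open>z\<close> be the \<open>phi\<close>-weighted mean of the local iterates and \<open>\<delta>\<close> the total length of the local
  directions. Push-sum mixing over a window of \<open>I * B\<close> steps contracts the diameters of the local
  iterates and of the tracked gradients, so the sums of their squares are bounded by a constant plus
  a multiple of \<open>\<Sum> (\<gamma> * \<delta>)\<^sup>2\<close>. The energy \<open>F z\<close> plus the \<open>phi\<close>-weighted mean of the local values of
  \<open>G\<close> decreases by a multiple of \<open>\<gamma> * \<delta>\<^sup>2\<close> up to these squared consensus errors. Hence, once the
  steps are small, \<open>\<Sum> \<gamma> * \<delta>\<^sup>2\<close> is finite and the consensus errors vanish. The prox residual at \<open>z\<close>
  is bounded by \<open>\<delta>\<close> plus consensus errors, and it moves by at most a multiple of \<open>\<gamma> * \<delta>\<close> per step;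
  as \<open>\<Sum> \<gamma>\<close> diverges, it tends to zero. Diminishing and small constant steps are both covered, since
  only eventual smallness of the steps is used.
\<close>

section \<open>Convex combinations and scalar sequences\<close>

lemma diameter_image_bound:
  assumes "i < I" "j < I"
  shows "norm (v i - v j) \<le> diameter (v ` {..<I::nat})"
  using diameter_bounded_bound[of "v ` {..<I}" "v i" "v j"] assms
  by (simp add: finite_imp_bounded dist_norm)

lemma diameter_image_nonneg: "0 \<le> diameter (v ` {..<I::nat})"
  by (rule diameter_ge_0) (simp add: finite_imp_bounded)

lemma norm_convex_combination_le:
  fixes v :: "'b \<Rightarrow> 'a::real_normed_vector"
  assumes "finite S" "\<And>j. j \<in> S \<Longrightarrow> 0 \<le> c j" "sum c S = 1" "\<And>j. j \<in> S \<Longrightarrow> norm (v j) \<le> M"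
  shows "norm (\<Sum>j\<in>S. c j *\<^sub>R v j) \<le> M"
proof -
  have "norm (\<Sum>j\<in>S. c j *\<^sub>R v j) \<le> (\<Sum>j\<in>S. c j * M)"
    by (rule sum_norm_le) (use assms in \<open>auto intro: mult_left_mono\<close>)
  then show ?thesis using assms(3) by (simp flip: sum_distrib_right)
qed

lemma norm_diff_convex_combination_le:
  fixes v :: "'b \<Rightarrow> 'a::real_normed_vector"
  assumes "finite S" "\<And>j. j \<in> S \<Longrightarrow> 0 \<le> c j" "sum c S = 1" "\<And>j. j \<in> S \<Longrightarrow> norm (v j - w) \<le> M"
  shows "norm ((\<Sum>j\<in>S. c j *\<^sub>R v j) - w) \<le> M"
proof -
  have "(\<Sum>j\<in>S. c j *\<^sub>R v j) - w = (\<Sum>j\<in>S. c j *\<^sub>R (v j - w))"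
    using assms(3) by (simp add: scaleR_diff_right sum_subtractf flip: scaleR_left.sum)
  then show ?thesis using norm_convex_combination_le[OF assms] by simp
qed

text \<open>Dobrushin contraction: removing the common mass \<open>\<eta>\<close> of two probability vectors leaves
  two vectors of total mass \<open>1 - card S * \<eta>\<close>, which are compared pairwise.\<close>

lemma norm_diff_convex_combinations_le:
  fixes v :: "'b \<Rightarrow> 'a::real_normed_vector" and \<eta> M :: real
  assumes S: "finite S" and p: "sum p S = 1" "\<And>j. j \<in> S \<Longrightarrow> \<eta> \<le> p j"
    and q: "sum q S = 1" "\<And>j. j \<in> S \<Longrightarrow> \<eta> \<le> q j"
    and v: "\<And>j l. j \<in> S \<Longrightarrow> l \<in> S \<Longrightarrow> norm (v j - v l) \<le> M"
  shows "norm ((\<Sum>j\<in>S. p j *\<^sub>R v j) - (\<Sum>j\<in>S. q j *\<^sub>R v j)) \<le> (1 - card S * \<eta>) * M"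
proof -
  define s where "s = 1 - card S * \<eta>"
  define p' q' where "p' j = p j - \<eta>" and "q' j = q j - \<eta>" for j
  have p': "sum p' S = s" "\<And>j. j \<in> S \<Longrightarrow> 0 \<le> p' j" and q': "sum q' S = s" "\<And>j. j \<in> S \<Longrightarrow> 0 \<le> q' j"
    using p q by (simp_all add: p'_def q'_def s_def sum_subtractf)
  have s: "0 \<le> s" using p' sum_nonneg by metis
  have eq: "(\<Sum>j\<in>S. p j *\<^sub>R v j) - (\<Sum>j\<in>S. q j *\<^sub>R v j) = (\<Sum>j\<in>S. p' j *\<^sub>R v j) - (\<Sum>j\<in>S. q' j *\<^sub>R v j)"
    by (simp add: p'_def q'_def scaleR_diff_left sum_subtractf)
  show ?thesis
  proof (cases "s = 0")
    case True
    have "\<And>j. j \<in> S \<Longrightarrow> p' j = 0" "\<And>j. j \<in> S \<Longrightarrow> q' j = 0"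
      using p' q' True S by (auto simp: sum_nonneg_eq_0_iff)
    then show ?thesis using True s_def by (simp add: eq)
  next
    case False
    have "s *\<^sub>R ((\<Sum>j\<in>S. p' j *\<^sub>R v j) - (\<Sum>l\<in>S. q' l *\<^sub>R v l)) = (\<Sum>j\<in>S. \<Sum>l\<in>S. (p' j * q' l) *\<^sub>R (v j - v l))"
    proof -
      have "(\<Sum>j\<in>S. \<Sum>l\<in>S. (p' j * q' l) *\<^sub>R v j) = s *\<^sub>R (\<Sum>j\<in>S. p' j *\<^sub>R v j)"
        by (simp add: scaleR_right.sum mult.commute q'(1) flip: scaleR_left.sum sum_distrib_left)
      moreover have "(\<Sum>j\<in>S. \<Sum>l\<in>S. (p' j * q' l) *\<^sub>R v l) = s *\<^sub>R (\<Sum>j\<in>S. q' j *\<^sub>R v j)"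
        by (subst sum.swap) (simp add: scaleR_right.sum p'(1) flip: scaleR_left.sum sum_distrib_right)
      ultimately show ?thesis
        by (simp add: scaleR_diff_right sum_subtractf)
    qed
    then have "norm (s *\<^sub>R ((\<Sum>j\<in>S. p' j *\<^sub>R v j) - (\<Sum>l\<in>S. q' l *\<^sub>R v l))) \<le> (\<Sum>j\<in>S. \<Sum>l\<in>S. p' j * q' l * M)"
      by (auto intro!: sum_norm_le mult_left_mono v simp: p' q')
    also have "\<dots> = s * s * M"
      by (simp add: p' q' flip: sum_distrib_left sum_distrib_right)
    finally have "s * norm ((\<Sum>j\<in>S. p' j *\<^sub>R v j) - (\<Sum>l\<in>S. q' l *\<^sub>R v l)) \<le> s * (s * M)"
      using s by (simp add: mult.assoc)
    then show ?thesis using False s by (simp add: eq flip: s_def)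
  qed
qed

text \<open>Convexity of the square turns the contraction of \<open>D\<close> over \<open>N\<close>
  steps into one of its square with the same rate. Summing over \<open>k\<close> lets the left side
  absorb the \<open>\<rho>\<close> part, and each \<open>\<epsilon>\<close> occurs in at most
  \<open>N\<close> windows.\<close>

lemma sum_squares_of_contraction:
  fixes D \<epsilon> :: "nat \<Rightarrow> real"
  assumes D: "\<And>k. 0 \<le> D k" and \<epsilon>: "\<And>k. 0 \<le> \<epsilon> k" and \<rho>: "0 \<le> \<rho>" "\<rho> < 1"
    and step: "\<And>k. D (k + N) \<le> \<rho> * D k + (\<Sum>t<N. \<epsilon> (k + t))"
  shows "(\<Sum>k<m. (D k)\<^sup>2) \<le> ((\<Sum>k<N. (D k)\<^sup>2) + real N ^ 2 / (1 - \<rho>) * (\<Sum>k<m. (\<epsilon> k)\<^sup>2)) / (1 - \<rho>)"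
proof -
  have step2: "(D (k + N))\<^sup>2 \<le> \<rho> * (D k)\<^sup>2 + real N / (1 - \<rho>) * (\<Sum>t<N. (\<epsilon> (k + t))\<^sup>2)" for k
  proof -
    define S where "S = (\<Sum>t<N. \<epsilon> (k + t))"
    have S: "S\<^sup>2 \<le> real N * (\<Sum>t<N. (\<epsilon> (k + t))\<^sup>2)"
      using sum_squared_le_sum_of_squares[of "\<lambda>t. \<epsilon> (k + t)" "{..<N}"] by (simp add: S_def mult.commute)
    have "(D (k + N))\<^sup>2 \<le> (\<rho> * D k + S)\<^sup>2"
      by (rule power_mono) (use step D S_def in auto)
    also have "\<dots> \<le> \<rho> * (D k)\<^sup>2 + S\<^sup>2 / (1 - \<rho>)"
    proof -
      \<comment> \<open>This is Jensen's inequality for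
        \<open>\<rho> * D k + (1 - \<rho>) * (S / (1 - \<rho>))\<close>, with the gap written as an
        explicit square.\<close>
      have "\<rho> * (D k)\<^sup>2 + S\<^sup>2 / (1 - \<rho>) - (\<rho> * D k + S)\<^sup>2 = \<rho> / (1 - \<rho>) * ((1 - \<rho>) * D k - S)\<^sup>2"
        using \<rho> by (simp add: field_simps power2_eq_square)
      then show ?thesis using \<rho> by (smt (verit) divide_nonneg_pos mult_nonneg_nonneg zero_le_power2)
    qed
    also have "S\<^sup>2 / (1 - \<rho>) \<le> real N / (1 - \<rho>) * (\<Sum>t<N. (\<epsilon> (k + t))\<^sup>2)"
      using S \<rho> by (simp add: divide_right_mono)
    finally show ?thesis by simp
  qed
  define C where "C = real N / (1 - \<rho>)"
  have C: "0 \<le> C" using \<rho> by (simp add: C_def)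
  \<comment> \<open>The recursion only controls terms of index at least \<open>N\<close>, so the
    first \<open>N\<close> terms are carried separately; for \<open>m < N\<close> they already cover
    the whole sum.\<close>
  have "(1 - \<rho>) * (\<Sum>k<m. (D k)\<^sup>2) \<le> (\<Sum>k<N. (D k)\<^sup>2) + C * N * (\<Sum>k<m. (\<epsilon> k)\<^sup>2)"
  proof (cases "N \<le> m")
    case False
    have "(1 - \<rho>) * (\<Sum>k<m. (D k)\<^sup>2) \<le> 1 * (\<Sum>k<m. (D k)\<^sup>2)"
      by (rule mult_right_mono) (use \<rho> in \<open>auto intro: sum_nonneg\<close>)
    also have "\<dots> \<le> (\<Sum>k<N. (D k)\<^sup>2)"
      using False by (auto intro: sum_mono2)
    finally show ?thesis using C by (smt (verit) mult_nonneg_nonneg of_nat_0_le_iff sum_nonneg zero_le_power2)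
  next
    case True
    then obtain n where m: "m = N + n" using le_Suc_ex by blast
    have "(\<Sum>k<m. (D k)\<^sup>2) = (\<Sum>k<N. (D k)\<^sup>2) + (\<Sum>k<n. (D (k + N))\<^sup>2)"
      unfolding m by (induction n) (simp_all add: add.commute)
    also have "(\<Sum>k<n. (D (k + N))\<^sup>2) \<le> (\<Sum>k<n. \<rho> * (D k)\<^sup>2 + C * (\<Sum>t<N. (\<epsilon> (k + t))\<^sup>2))"
      using step2 by (intro sum_mono) (simp add: C_def)
    also have "\<dots> = \<rho> * (\<Sum>k<n. (D k)\<^sup>2) + C * (\<Sum>t<N. \<Sum>k<n. (\<epsilon> (k + t))\<^sup>2)"
      by (simp add: sum.distrib sum_distrib_left sum.swap[of _ "{..<n}"])
    also have "\<dots> \<le> \<rho> * (\<Sum>k<m. (D k)\<^sup>2) + C * (\<Sum>t<N. \<Sum>k<m. (\<epsilon> k)\<^sup>2)"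
    proof (intro add_mono mult_left_mono sum_mono)
      show "(\<Sum>k<n. (D k)\<^sup>2) \<le> (\<Sum>k<m. (D k)\<^sup>2)"
        unfolding m by (rule sum_mono2) auto
      fix t assume t: "t \<in> {..<N}"
      have "(\<Sum>k<n. (\<epsilon> (k + t))\<^sup>2) = (\<Sum>k\<in>(\<lambda>k. k + t) ` {..<n}. (\<epsilon> k)\<^sup>2)"
        by (subst sum.reindex) (auto simp: inj_on_def)
      also have "\<dots> \<le> (\<Sum>k<m. (\<epsilon> k)\<^sup>2)"
        by (rule sum_mono2) (use t m in auto)
      finally show "(\<Sum>k<n. (\<epsilon> (k + t))\<^sup>2) \<le> (\<Sum>k<m. (\<epsilon> k)\<^sup>2)" .
    qed (use \<rho> C in auto)
    finally show ?thesis by (simp add: algebra_simps)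
  qed
  then show ?thesis using \<rho> by (simp add: C_def pos_le_divide_eq power2_eq_square mult.commute)
qed

lemma summable_of_partial_sums_le:
  fixes s :: "nat \<Rightarrow> real"
  assumes "\<And>k. 0 \<le> s k" "\<And>m. (\<Sum>k<m. s k) \<le> c"
  shows "summable s"
  by (rule bounded_imp_summable[of s c]) (use assms in \<open>simp_all del: sum.lessThan_Suc flip: lessThan_Suc_atMost\<close>)

text \<open>Above any fixed positive level the increments of \<open>J\<close> are controlled by the summable sequence
  \<open>\<gamma> k * (\<delta> k)\<^sup>2\<close>, and \<open>J\<close> returns below that level infinitely often.\<close>

lemma tendsto_zero_of_controlled_increments:
  fixes J e \<delta> \<gamma> :: "nat \<Rightarrow> real"
  assumes \<gamma>: "\<And>k. 0 < \<gamma> k" "\<And>k. \<gamma> k \<le> 1" "\<not> summable \<gamma>"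
    and \<delta>: "\<And>k. 0 \<le> \<delta> k" "summable (\<lambda>k. \<gamma> k * (\<delta> k)\<^sup>2)"
    and J: "\<And>k. 0 \<le> J k" "\<And>k. J k \<le> C * \<delta> k + e k" "\<And>k. J (Suc k) \<le> J k + C * (\<gamma> k * \<delta> k)"
    and C: "0 < C" and e: "e \<longlonglongrightarrow> 0"
  shows "J \<longlonglongrightarrow> 0"
proof (rule LIMSEQ_I)
  fix r :: real assume "0 < r"
  define d where "d = r / 2"
  have d: "0 < d" using \<open>0 < r\<close> by (simp add: d_def)
  \<comment> \<open>Where \<open>J k\<close> is at least \<open>d\<close> and the error at most
    \<open>d / 2\<close>, the factor \<open>C * \<delta> k / (d / 2)\<close> is at least 1;
    multiplying the increment by it yields \<open>K * s k\<close>.\<close>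
  define K where "K = 2 * C\<^sup>2 / d"
  define s where "s k = \<gamma> k * (\<delta> k)\<^sup>2" for k
  have s0: "0 \<le> s k" for k using \<gamma>(1)[of k] by (simp add: s_def)
  have K: "0 < K" using C d by (simp add: K_def)
  have sum_s: "summable s" using \<delta>(2) by (simp add: s_def[abs_def])
  have ev: "\<forall>\<^sub>F k in sequentially. e k < d / 2"
    using order_tendstoD(2)[OF e, of "d / 2"] d by simp
  have "(\<lambda>k. sqrt (s k)) \<longlonglongrightarrow> 0"
    using tendsto_real_sqrt[OF summable_LIMSEQ_zero[OF sum_s]] by simp
  then have ev2: "\<forall>\<^sub>F k in sequentially. sqrt (s k) < d / (2 * C)"
    using d C by (intro order_tendstoD(2)) auto
  obtain N0 where N0: "\<And>k. k \<ge> N0 \<Longrightarrow> e k < d / 2 \<and> sqrt (s k) < d / (2 * C)"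
    using eventually_conj[OF ev ev2] unfolding eventually_sequentially by blast
  obtain N1 where N1: "\<And>m n. m \<ge> N1 \<Longrightarrow> \<bar>sum s {m..<n}\<bar> < d / (2 * K)"
    using summable_Cauchy[of s] sum_s d K by (metis divide_pos_pos mult_pos_pos real_norm_def zero_less_numeral)
  define N where "N = max N0 N1"
  have small: "C * (\<gamma> k * \<delta> k) < d / 2" if "k \<ge> N" for k
  proof -
    have "(\<gamma> k * \<delta> k)\<^sup>2 \<le> s k"
      using mult_right_mono[OF \<gamma>(2) s0, of k k] by (simp add: s_def power2_eq_square mult_ac)
    then have "\<gamma> k * \<delta> k \<le> sqrt (s k)" by (rule real_le_rsqrt)
    also have "\<dots> < d / (2 * C)" using N0 that by (simp add: N_def)
    finally show ?thesis using C by (simp add: field_simps)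
  qed
  have big: "C * (\<gamma> k * \<delta> k) \<le> K * s k \<and> d / (2 * C) \<le> \<delta> k" if "k \<ge> N" "d \<le> J k" for k
  proof -
    have "d \<le> C * \<delta> k + e k" using J(2)[of k] that by linarith
    then have 1: "d / 2 \<le> C * \<delta> k" using N0[of k] that by (simp add: N_def)
    have "(d / 2) * (C * (\<gamma> k * \<delta> k)) \<le> (C * \<delta> k) * (C * (\<gamma> k * \<delta> k))"
      by (rule mult_right_mono[OF 1]) (use C \<gamma>(1)[of k] \<delta>(1)[of k] in auto)
    then show ?thesis using 1 d C by (simp add: K_def s_def field_simps power2_eq_square)
  qed
  have "\<exists>k\<ge>N. J k < d"
  proof (rule ccontr)
    assume "\<not> ?thesis"
    then have *: "d \<le> J k" if "k \<ge> N" for k using that by force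
    \<comment> \<open>If \<open>J\<close> stayed above \<open>d\<close>, then
      \<open>\<delta>\<close> would stay above a positive constant and \<open>\<gamma>\<close> would
      be dominated by a multiple of \<open>s\<close>.\<close>
    have "norm (\<gamma> k) \<le> s k / (d / (2 * C))\<^sup>2" if "k \<ge> N" for k
    proof -
      have "\<gamma> k * (d / (2 * C))\<^sup>2 \<le> \<gamma> k * (\<delta> k)\<^sup>2"
        using big[OF that *[OF that]] \<gamma>(1)[of k] d C by (intro mult_left_mono power_mono) auto
      then show ?thesis using d C \<gamma>(1)[of k] by (simp add: s_def pos_le_divide_eq)
    qed
    then have "summable \<gamma>"
      by (intro summable_comparison_test[OF _ summable_divide[OF sum_s]]) blast
    then show False using \<gamma>(3) by simp
  qed
  then obtain k where k: "k \<ge> N" "J k < d" by blast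
  \<comment> \<open>From below \<open>d\<close> a single step overshoots by less than
    \<open>d / 2\<close>; above \<open>d\<close> every increment is charged to \<open>s\<close>. The
    tail of \<open>s\<close> costs another \<open>d / 2\<close>, for a total of
    \<open>r\<close>.\<close>
  have "J n < d + d / 2 + K * sum s {k..<n}" if "n \<ge> k" for n
    using that
  proof (induction n rule: dec_induct)
    case base then show ?case using k d by simp
  next
    case (step n)
    have nN: "n \<ge> N" using step k by simp
    have nn: "0 \<le> K * sum s {k..<n}" using K s0 by (simp add: sum_nonneg)
    show ?case
    proof (cases "d \<le> J n")
      case True
      then show ?thesis using big[OF nN True] J(3)[of n] step by (simp add: algebra_simps)
    next
      case False
      have "0 \<le> K * s n" using K s0[of n] by simp
      then show ?thesis using small[OF nN] J(3)[of n] False nn step by (simp add: algebra_simps)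
    qed
  qed
  moreover have "K * sum s {k..<n} < d / 2" for n
    using N1[of k n] k K by (simp add: N_def field_simps abs_of_nonneg sum_nonneg s0)
  ultimately have "J n < r" if "n \<ge> k" for n
    using that unfolding d_def by (smt (verit) field_sum_of_halves)
  then show "\<exists>no. \<forall>n\<ge>no. norm (J n - 0) < r" using J(1) by auto
qed

section \<open>Convex optimization\<close>

lemma has_real_derivative_along_line:
  fixes h :: "'a::real_inner \<Rightarrow> real"
  assumes "(h has_derivative (\<lambda>u. s \<bullet> u)) (at (p + t *\<^sub>R v))"
  shows "((\<lambda>t. h (p + t *\<^sub>R v)) has_real_derivative s \<bullet> v) (at t)"
proof -
  have "((\<lambda>t. p + t *\<^sub>R v) has_derivative (\<lambda>e. e *\<^sub>R v)) (at t)"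
    by (auto intro!: derivative_eq_intros)
  from has_derivative_compose[OF this assms]
  show ?thesis by (simp add: has_field_derivative_def mult_commute_abs)
qed

text \<open>\<open>G\<close> may be nonsmooth, so along the segment from \<open>p\<close> to
  \<open>w\<close> it is replaced by its chord, which lies above it. The resulting \<open>q\<close>
  is differentiable, and a negative slope at 0 would contradict minimality.\<close>

lemma minimizer_on_variational:
  fixes h :: "'a::euclidean_space \<Rightarrow> real"
  assumes min: "minimizer_on X (\<lambda>w. h w + G w) p"
    and h: "(h has_derivative (\<lambda>u. s \<bullet> u)) (at p)" and G: "convex_on X G" and w: "w \<in> X"
  shows "0 \<le> s \<bullet> (w - p) + G w - G p"
proof (rule ccontr)
  assume neg: "\<not> ?thesis"
  define q where "q t = h (p + t *\<^sub>R (w - p)) + t * (G w - G p)" for t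
  have "(q has_real_derivative s \<bullet> (w - p) + (G w - G p)) (at 0)"
    unfolding q_def using h by (auto intro!: derivative_eq_intros has_real_derivative_along_line)
  from has_real_derivative_neg_dec_right[OF this] neg
  obtain d where d: "0 < d" "\<And>e. 0 < e \<Longrightarrow> e < d \<Longrightarrow> q e < q 0" by auto
  define e where "e = min (d / 2) 1"
  have e: "0 < e" "e < d" "e \<le> 1" using d by (auto simp: e_def)
  have p: "p \<in> X" using min by (simp add: minimizer_on_def)
  have eq: "p + e *\<^sub>R (w - p) = (1 - e) *\<^sub>R p + e *\<^sub>R w" by (simp add: algebra_simps)
  have "(1 - e) *\<^sub>R p + e *\<^sub>R w \<in> X"
    using G p w e by (auto simp: convex_on_def intro!: convexD)
  then have "h p + G p \<le> h (p + e *\<^sub>R (w - p)) + G ((1 - e) *\<^sub>R p + e *\<^sub>R w)"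
    using min by (simp add: minimizer_on_def eq)
  moreover have "G ((1 - e) *\<^sub>R p + e *\<^sub>R w) \<le> (1 - e) * G p + e * G w"
    using convex_onD[OF G, of e p w] e p w by simp
  ultimately show False
    using d(2)[OF e(1,2)] by (simp add: q_def algebra_simps)
qed

text \<open>Strong convexity says exactly that \<open>q\<close> does not exceed \<open>q 0\<close>
  on the unit interval, whereas failure of the claim would give \<open>q\<close> a positive slope at
  0.\<close>

lemma strongly_convex_on_gradient_ge:
  fixes h :: "'a::euclidean_space \<Rightarrow> real"
  assumes sc: "strongly_convex_on \<tau> X h" and xy: "x \<in> X" "y \<in> X"
    and h: "(h has_derivative (\<lambda>u. s \<bullet> u)) (at x)"
  shows "h x + s \<bullet> (y - x) + \<tau> / 2 * (norm (y - x))\<^sup>2 \<le> h y"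
proof (rule ccontr)
  assume neg: "\<not> ?thesis"
  define n where "n = \<tau> / 2 * (norm (y - x))\<^sup>2"
  define q where "q t = h (x + t *\<^sub>R (y - x)) - t * (h y - h x) + t * (1 - t) * n" for t
  have "(q has_real_derivative s \<bullet> (y - x) - (h y - h x) + n) (at 0)"
    unfolding q_def using h by (auto intro!: derivative_eq_intros has_real_derivative_along_line)
  from has_real_derivative_pos_inc_right[OF this] neg
  obtain d where d: "0 < d" "\<And>e. 0 < e \<Longrightarrow> e < d \<Longrightarrow> q 0 < q e" by (auto simp: n_def)
  define e where "e = min (d / 2) 1"
  have e: "0 < e" "e < d" "e \<le> 1" using d by (auto simp: e_def)
  have "h (e *\<^sub>R y + (1 - e) *\<^sub>R x) \<le> e * h y + (1 - e) * h x - \<tau> / 2 * e * (1 - e) * (norm (y - x))\<^sup>2"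
    using sc xy e unfolding strongly_convex_on_def by auto
  moreover have "e *\<^sub>R y + (1 - e) *\<^sub>R x = x + e *\<^sub>R (y - x)" by (simp add: algebra_simps)
  ultimately have "q e \<le> q 0"
    by (simp add: q_def n_def algebra_simps)
  then show False using d(2)[OF e(1,2)] by simp
qed

lemma strongly_convex_on_gradient_monotone:
  fixes h :: "'a::euclidean_space \<Rightarrow> real"
  assumes sc: "strongly_convex_on \<tau> X h" and xy: "x \<in> X" "y \<in> X"
    and h: "\<And>x. x \<in> X \<Longrightarrow> (h has_derivative (\<lambda>u. g x \<bullet> u)) (at x)"
  shows "\<tau> * (norm (y - x))\<^sup>2 \<le> (g y - g x) \<bullet> (y - x)"
  using strongly_convex_on_gradient_ge[OF sc xy h[OF xy(1)]]
    strongly_convex_on_gradient_ge[OF sc xy(2,1) h[OF xy(2)]]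
  by (simp add: norm_minus_commute inner_diff algebra_simps)

text \<open>The mean value theorem alone gives the constant \<open>M\<close> rather than the sharp
  \<open>M / 2\<close>; this affects only the size of \<open>curvature\<close>.\<close>

lemma lipschitz_gradient_upper_bound:
  fixes h :: "'a::euclidean_space \<Rightarrow> real"
  assumes X: "convex X" and xy: "x \<in> X" "y \<in> X"
    and h: "\<And>x. x \<in> X \<Longrightarrow> (h has_derivative (\<lambda>u. g x \<bullet> u)) (at x)" and g: "M-lipschitz_on X g"
  shows "h y \<le> h x + g x \<bullet> (y - x) + M * (norm (y - x))\<^sup>2"
proof -
  have seg: "x + t *\<^sub>R (y - x) \<in> X" if "0 \<le> t" "t \<le> 1" for t
    using convexD[OF X xy, of "1 - t" t] that by (simp add: algebra_simps)
  have "\<exists>t>0. t < 1 \<and> h (x + 1 *\<^sub>R (y - x)) - h (x + 0 *\<^sub>R (y - x)) = (1 - 0) * (g (x + t *\<^sub>R (y - x)) \<bullet> (y - x))"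
    by (rule MVT2) (auto intro!: has_real_derivative_along_line h seg)
  then obtain t where t: "0 < t" "t < 1" and eq: "h y - h x = g (x + t *\<^sub>R (y - x)) \<bullet> (y - x)"
    by auto
  have "h y - h x - g x \<bullet> (y - x) \<le> norm (g (x + t *\<^sub>R (y - x)) - g x) * norm (y - x)"
    using norm_cauchy_schwarz[of "g (x + t *\<^sub>R (y - x)) - g x" "y - x"] by (simp add: eq inner_diff_left)
  also have "norm (g (x + t *\<^sub>R (y - x)) - g x) \<le> M * (t * norm (y - x))"
    using lipschitz_onD[OF g seg xy(1), of t] t by (simp add: dist_norm)
  also have "\<dots> \<le> M * norm (y - x)"
    using t lipschitz_on_nonneg[OF g] by (intro mult_left_mono) (auto intro: mult_left_le_one_le)
  finally show ?thesis by (simp add: mult_right_mono power2_eq_square)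
qed

text \<open>\<open>X\<close> may be unbounded and \<open>G\<close> unbounded below, so coercivity
  has to be shown: by convexity \<open>G\<close> decays at most linearly along rays from
  \<open>z\<close>, and the quadratic term wins.\<close>

lemma prox_minimizer_exists:
  fixes X :: "'a::euclidean_space set"
  assumes X: "closed X" and z: "z \<in> X" and G: "convex_on X G" "continuous_on X G"
  shows "\<exists>p. minimizer_on X (\<lambda>w. g \<bullet> (w - z) + 1/2 * (norm (w - z))\<^sup>2 + G w) p"
proof -
  have cont: "continuous_on (X \<inter> S) G" for S by (rule continuous_on_subset[OF G(2)]) auto
  have comp: "compact (X \<inter> cball z R)" for R using X by (simp add: closed_Int_compact)
  obtain u where u: "u \<in> X \<inter> cball z 1" "\<And>w. w \<in> X \<inter> cball z 1 \<Longrightarrow> G u \<le> G w"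
    using continuous_attains_inf[OF comp _ cont] z by (metis Int_iff centre_in_cball empty_iff zero_le_one)
  \<comment> \<open>Beyond this radius the quadratic term outweighs \<open>norm g\<close> and the
    linear decay of \<open>G\<close>, so the objective is at least its value \<open>G z\<close> at
    \<open>z\<close>.\<close>
  define R where "R = max 1 (2 * (norm g + G z - G u))"
  define h where "h w = g \<bullet> (w - z) + 1/2 * (norm (w - z))\<^sup>2 + G w" for w
  have "continuous_on (X \<inter> cball z R) h"
    unfolding h_def by (intro continuous_intros cont)
  then obtain p where p: "p \<in> X \<inter> cball z R" "\<And>w. w \<in> X \<inter> cball z R \<Longrightarrow> h p \<le> h w"
    using continuous_attains_inf[OF comp[of R]] z
    by (metis Int_iff R_def centre_in_cball empty_iff max.coboundedI1 zero_le_one)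
  have "h p \<le> h w" if w: "w \<in> X" for w
  proof (cases "w \<in> cball z R")
    case True then show ?thesis using p w by simp
  next
    case False
    define r where "r = norm (w - z)"
    have r: "1 < r" "2 * (norm g + G z - G u) < r"
      using False by (auto simp: R_def r_def dist_norm norm_minus_commute)
    \<comment> \<open>The point at distance 1 from \<open>z\<close> on the segment to
      \<open>w\<close>; there \<open>G\<close> is at least \<open>G u\<close>, which bounds
      \<open>G w\<close> below by convexity.\<close>
    define v where "v = (1 - 1 / r) *\<^sub>R z + (1 / r) *\<^sub>R w"
    have "v \<in> X" using G(1) z w r by (auto simp: convex_on_def v_def intro!: convexD)
    moreover have "v - z = (1 / r) *\<^sub>R (w - z)" by (simp add: v_def algebra_simps)
    then have "v \<in> cball z 1" using r by (simp add: dist_norm norm_minus_commute flip: r_def)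
    ultimately have "G u \<le> G v" using u by simp
    also have "\<dots> \<le> (1 - 1 / r) * G z + (1 / r) * G w"
      unfolding v_def by (rule convex_onD[OF G(1)]) (use r z w in auto)
    finally have "r * G u \<le> r * ((1 - 1 / r) * G z + (1 / r) * G w)"
      using r by (intro mult_left_mono) auto
    also have "\<dots> = (r - 1) * G z + G w" using r by (simp add: field_simps)
    finally have 1: "r * (G u - G z) + G z \<le> G w" by (simp add: algebra_simps)
    have 2: "- (norm g * r) \<le> g \<bullet> (w - z)"
      using norm_cauchy_schwarz[of "-g" "w - z"] by (simp add: r_def)
    have "r * (2 * (norm g + G z - G u)) \<le> r * r" using r by (intro mult_left_mono) auto
    then have "G z \<le> h w" using 1 2 by (simp add: h_def power2_eq_square algebra_simps flip: r_def)
    moreover have "h p \<le> h z" using p z by (simp add: R_def)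
    ultimately show ?thesis by (simp add: h_def)
  qed
  then show ?thesis using p by (auto simp: minimizer_on_def h_def)
qed

lemma prox_objective_has_derivative:
  fixes z g :: "'a::euclidean_space"
  shows "((\<lambda>w. g \<bullet> (w - z) + 1/2 * (norm (w - z))\<^sup>2) has_derivative (\<lambda>u. (g + (p - z)) \<bullet> u)) (at p)"
  unfolding power2_norm_eq_inner
  by (auto intro!: derivative_eq_intros simp: fun_eq_iff inner_add_left inner_add_right inner_diff_left inner_diff_right inner_commute)

text \<open>Each first-order condition is tested at the other minimizer; in the sum the values of
  \<open>G\<close> cancel and the quadratic terms leave the squared distance. Equal data give
  uniqueness.\<close>

lemma prox_minimizers_dist_le:
  fixes X :: "'a::euclidean_space set"
  assumes G: "convex_on X G"
    and p: "minimizer_on X (\<lambda>w. g \<bullet> (w - z) + 1/2 * (norm (w - z))\<^sup>2 + G w) p"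
    and q: "minimizer_on X (\<lambda>w. g' \<bullet> (w - z') + 1/2 * (norm (w - z'))\<^sup>2 + G w) q"
  shows "norm (p - q) \<le> norm (g - g') + norm (z - z')"
proof -
  have "p \<in> X" "q \<in> X" using p q by (simp_all add: minimizer_on_def)
  then have "0 \<le> (g + (p - z)) \<bullet> (q - p) + G q - G p" "0 \<le> (g' + (q - z')) \<bullet> (p - q) + G p - G q"
    using minimizer_on_variational[OF p prox_objective_has_derivative G]
      minimizer_on_variational[OF q prox_objective_has_derivative G] by blast+
  then have "(p - q) \<bullet> (p - q) \<le> ((z - z') - (g - g')) \<bullet> (p - q)"
    by (simp add: inner_diff inner_add algebra_simps)
  also have "\<dots> \<le> norm ((z - z') - (g - g')) * norm (p - q)" by (rule norm_cauchy_schwarz)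
  finally have "norm (p - q) \<le> norm ((z - z') - (g - g'))"
    by (cases "p = q") (auto simp: power2_eq_square simp flip: power2_norm_eq_inner)
  then show ?thesis using norm_triangle_ineq4[of "z - z'" "g - g'"] by linarith
qed

lemma prox_point_minimizer:
  fixes X :: "'a::euclidean_space set"
  assumes X: "closed X" and z: "z \<in> X" and G: "convex_on X G" "continuous_on X G"
  shows "minimizer_on X (\<lambda>w. g \<bullet> (w - z) + 1/2 * (norm (w - z))\<^sup>2 + G w) (prox_point X G g z)"
proof -
  obtain p where p: "minimizer_on X (\<lambda>w. g \<bullet> (w - z) + 1/2 * (norm (w - z))\<^sup>2 + G w) p"
    using prox_minimizer_exists[OF assms] by blast
  show ?thesis unfolding prox_point_def
    by (rule theI[where a = p]) (use p prox_minimizers_dist_le[OF G(1) _ p] in fastforce)+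
qed

section \<open>Push-sum consensus over time-varying digraphs\<close>

lemma rtrancl_leaves_set:
  assumes "(p, q) \<in> R\<^sup>*" "p \<in> S" "q \<notin> S"
  obtains a b where "(a, b) \<in> R" "a \<in> S" "b \<notin> S"
  using assms by (induction rule: rtrancl_induct) blast+

locale weighted_digraphs =
  fixes I :: nat and E :: "nat \<Rightarrow> (nat \<times> nat) set" and B :: nat
    and A :: "nat \<Rightarrow> nat \<Rightarrow> nat \<Rightarrow> real" and \<kappa> :: real
  assumes I_pos: "0 < I"
    and edges: "\<And>k. E k \<subseteq> {..<I} \<times> {..<I}"
    and conn: "B_strongly_connected I E B"
    and \<kappa>_pos: "0 < \<kappa>"
    and compl: "\<And>k. compliant I (E k) \<kappa> (A k)"
    and stoch: "\<And>k. column_stochastic I (A k)"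
begin

section \<open>Weight matrices and their products\<close>

lemma A_nonneg: "i < I \<Longrightarrow> j < I \<Longrightarrow> 0 \<le> A k i j"
  using stoch by (simp add: column_stochastic_def)

lemma A_column_sum: "j < I \<Longrightarrow> (\<Sum>i<I. A k i j) = 1"
  using stoch by (simp add: column_stochastic_def)

lemma A_edge_ge: "i < I \<Longrightarrow> j < I \<Longrightarrow> j = i \<or> (j, i) \<in> E k \<Longrightarrow> \<kappa> \<le> A k i j"
  using compl[of k] by (auto simp: compliant_def)

lemma \<kappa>_le_1: "\<kappa> \<le> 1"
proof -
  have "\<kappa> \<le> A 0 0 0" using A_edge_ge I_pos by blast
  also have "\<dots> \<le> (\<Sum>i<I. A 0 i 0)"
    by (rule member_le_sum) (use I_pos A_nonneg in auto)
  finally show ?thesis using A_column_sum I_pos by simp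
qed

text \<open>The matrix product \<open>A (k + n - 1) ... A k\<close>, which carries mass from time
  \<open>k\<close> to time \<open>k + n\<close>.\<close>

primrec transition :: "nat \<Rightarrow> nat \<Rightarrow> nat \<Rightarrow> nat \<Rightarrow> real" where
  "transition k 0 i j = (if i = j then 1 else 0)"
| "transition k (Suc n) i j = (\<Sum>l<I. A (k + n) i l * transition k n l j)"

lemma transition_nonneg: "i < I \<Longrightarrow> 0 \<le> transition k n i j"
  by (induction n arbitrary: i) (auto intro!: sum_nonneg mult_nonneg_nonneg A_nonneg)

lemma transition_step_ge:
  assumes "i < I" "l < I" "l = i \<or> (l, i) \<in> E (k + n)" "\<kappa> ^ n \<le> transition k n l j"
  shows "\<kappa> ^ Suc n \<le> transition k (Suc n) i j"
proof -
  have "\<kappa> * \<kappa> ^ n \<le> A (k + n) i l * transition k n l j"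
    using assms A_edge_ge[of i l "k + n"] \<kappa>_pos by (intro mult_mono) (auto simp: A_nonneg)
  also have "\<dots> \<le> (\<Sum>l<I. A (k + n) i l * transition k n l j)"
    by (rule member_le_sum[of l _ "\<lambda>l. A (k + n) i l * transition k n l j"])
      (use assms A_nonneg transition_nonneg in auto)
  finally show ?thesis by simp
qed

text \<open>The set of nodes reached from \<open>j\<close> gains a node in every window of length \<open>B\<close>
  until it exhausts the network.\<close>

lemma transition_ge:
  assumes i: "i < I" and j: "j < I"
  shows "\<kappa> ^ (I * B) \<le> transition k (I * B) i j"
proof -
  define S where "S n = {i. i < I \<and> \<kappa> ^ n \<le> transition k n i j}" for n
  have fin: "finite (S n)" and sub: "S n \<subseteq> {..<I}" for n by (auto simp: S_def)
  have Suc: "S n \<subseteq> S (Suc n)" for n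
    using transition_step_ge[of _ _ k n j] by (auto simp: S_def)
  have mono: "S n \<subseteq> S m" if "n \<le> m" for n m
    using that Suc by (rule lift_Suc_mono_le[of S, rotated])
  have jS: "j \<in> S n" for n using mono[of 0 n] j by (auto simp: S_def)
  have grow: "card (S n) < card (S (n + B))" if ne: "S n \<noteq> {..<I}" for n
  proof -
    obtain q where q: "q < I" "q \<notin> S n" using ne sub[of n] by auto
    have "(j, q) \<in> (\<Union>t\<in>{k+n..<k+n+B}. E t)\<^sup>*"
      using conn j q by (auto simp: B_strongly_connected_def strongly_connected_on_def)
    then obtain a b where ab: "(a, b) \<in> (\<Union>t\<in>{k+n..<k+n+B}. E t)" "a \<in> S n" "b \<notin> S n"
      by (rule rtrancl_leaves_set[OF _ jS q(2)])
    then obtain t where t: "k + n \<le> t" "t < k + n + B" "(a, b) \<in> E t" by auto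
    define m where "m = t - k"
    have m: "t = k + m" "n \<le> m" "Suc m \<le> n + B" using t by (auto simp: m_def)
    have "a \<in> S m" "b < I" using mono[OF m(2)] ab edges t by auto
    then have "b \<in> S (Suc m)"
      using transition_step_ge[of b a k m j] t m unfolding S_def by blast
    then have "b \<in> S (n + B)" using mono[OF m(3)] by auto
    then have "S n \<subset> S (n + B)" using ab mono[of n "n + B"] by auto
    then show ?thesis by (rule psubset_card_mono[OF fin])
  qed
  \<comment> \<open>The count starts with \<open>j\<close> itself, hence the \<open>Suc\<close>;
    \<open>min\<close> accounts for saturation once all nodes are reached.\<close>
  have "min I (Suc n) \<le> card (S (n * B))" for n
  proof (induction n)
    case 0
    have "card {j} \<le> card (S 0)" using jS fin by (intro card_mono) auto
    then show ?case by simp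
  next
    case (Suc n)
    show ?case
    proof (cases "S (n * B) = {..<I}")
      case True
      then have "card {..<I} \<le> card (S (Suc n * B))" using mono[of "n * B" "Suc n * B"] fin
        by (intro card_mono) auto
      then show ?thesis by simp
    next
      case False
      then show ?thesis using grow[OF False] Suc by (simp add: add.commute)
    qed
  qed
  from this[of I] have "card {..<I} \<le> card (S (I * B))" by simp
  then have "S (I * B) = {..<I}" using card_seteq[OF _ sub] by blast
  then show ?thesis using i by (auto simp: S_def)
qed

text \<open>After this many steps every entry of the transition matrix is at least
  \<open>phi_min\<close>, the bound that also serves for the push-sum weights.\<close>

definition "window = I * B"
definition "phi_min = \<kappa> ^ window"
text \<open>Row normalization divides by a weight of at most \<open>I\<close>, so normalized entries
  are at least \<open>phi_min\<^sup>2 / I\<close>; the \<open>I\<close> entries of a row then share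
  mass \<open>phi_min\<^sup>2\<close>.\<close>

definition "rate = 1 - phi_min\<^sup>2"

lemma phi_min_pos: "0 < phi_min" using \<kappa>_pos by (simp add: phi_min_def)

lemma phi_min_le_1: "phi_min \<le> 1" using \<kappa>_pos \<kappa>_le_1 by (simp add: phi_min_def power_le_one)

lemma rate: "0 \<le> rate" "rate < 1"
  using phi_min_pos phi_min_le_1 by (simp_all add: rate_def power_le_one)

text \<open>The constant of \<open>sum_squares_of_contraction\<close> for perturbations
  \<open>2 * \<epsilon>\<close>, whence the factor 4.\<close>

definition "window_gain = 4 * (real window)\<^sup>2 / (1 - rate)\<^sup>2"

lemma window_gain_nonneg: "0 \<le> window_gain" by (simp add: window_gain_def)

end

section \<open>Push-sum weights and the induced averaging\<close>

locale push_sum = weighted_digraphs +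
  fixes phi :: "nat \<Rightarrow> nat \<Rightarrow> real"
  assumes phi_0: "\<And>i. i < I \<Longrightarrow> phi 0 i = 1"
    and phi_Suc: "\<And>k i. i < I \<Longrightarrow> phi (Suc k) i = (\<Sum>j<I. A k i j * phi k j)"
begin

lemma phi_transition: "i < I \<Longrightarrow> phi (k + n) i = (\<Sum>j<I. transition k n i j * phi k j)"
proof (induction n arbitrary: i)
  case 0
  then show ?case by (simp add: if_distrib[of "\<lambda>c. c * _"] sum.delta' cong: if_cong)
next
  case (Suc n)
  have "phi (k + Suc n) i = (\<Sum>l<I. A (k + n) i l * (\<Sum>j<I. transition k n l j * phi k j))"
    using Suc by (simp add: phi_Suc)
  also have "\<dots> = (\<Sum>j<I. transition k (Suc n) i j * phi k j)"
    unfolding sum_distrib_left by (subst sum.swap) (simp add: sum_distrib_right mult.assoc)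
  finally show ?case .
qed

lemma phi_sum: "(\<Sum>i<I. phi k i) = real I"
proof (induction k)
  case 0 then show ?case by (simp add: phi_0)
next
  case (Suc k)
  have "(\<Sum>i<I. phi (Suc k) i) = (\<Sum>j<I. \<Sum>i<I. A k i j * phi k j)"
    by (simp add: phi_Suc) (rule sum.swap)
  then show ?case using Suc A_column_sum by (simp flip: sum_distrib_right)
qed

lemma phi_nonneg: "i < I \<Longrightarrow> 0 \<le> phi k i"
  by (induction k arbitrary: i) (auto simp: phi_0 phi_Suc intro!: sum_nonneg mult_nonneg_nonneg A_nonneg)

text \<open>Within the first window the self-loops alone preserve \<open>\<kappa> ^ k\<close> of the
  initial unit mass. Later, every node receives at least the fraction \<open>phi_min\<close> of the
  total mass \<open>I\<close> present one window earlier.\<close>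

lemma phi_ge: assumes i: "i < I" shows "phi_min \<le> phi k i"
proof (cases "k < window")
  case True
  have "\<kappa> ^ k \<le> transition 0 k i i"
  proof (induction k)
    case (Suc k) show ?case by (rule transition_step_ge) (use i Suc in auto)
  qed simp
  also have "\<dots> = transition 0 k i i * phi 0 i" using i by (simp add: phi_0)
  also have "\<dots> \<le> (\<Sum>j<I. transition 0 k i j * phi 0 j)"
    by (rule member_le_sum[of i _ "\<lambda>j. transition 0 k i j * phi 0 j"])
      (use i transition_nonneg phi_nonneg in auto)
  also have "\<dots> = phi k i" using phi_transition[OF i, of 0 k] by simp
  finally show ?thesis
    using power_decreasing[of k window \<kappa>] True \<kappa>_pos \<kappa>_le_1 by (simp add: phi_min_def)
next
  case False
  then obtain n where n: "k = n + window" by (metis add.commute le_Suc_ex not_less)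
  have "phi_min * real I = (\<Sum>j<I. phi_min * phi n j)" by (simp add: phi_sum flip: sum_distrib_left)
  also have "\<dots> \<le> (\<Sum>j<I. transition n window i j * phi n j)"
    by (rule sum_mono) (use transition_ge[OF i] phi_nonneg in \<open>auto simp: phi_min_def window_def intro: mult_right_mono\<close>)
  also have "\<dots> = phi k i" using phi_transition[OF i] n by simp
  finally have "phi_min * real I \<le> phi k i" .
  moreover have "phi_min * 1 \<le> phi_min * real I"
    by (rule mult_left_mono) (use I_pos phi_min_pos in auto)
  ultimately show ?thesis by linarith
qed

lemma phi_pos: "i < I \<Longrightarrow> 0 < phi k i"
  using phi_ge phi_min_pos by (meson less_le_trans)

lemma phi_le: assumes i: "i < I" shows "phi k i \<le> real I"
  using member_le_sum[of i "{..<I}" "phi k"] i phi_nonneg by (simp add: phi_sum)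

text \<open>Dividing by the updated \<open>phi\<close> turns column-stochastic mixing into
  row-stochastic averaging, so updates become convex combinations.\<close>

definition "weight k i j = A k i j * phi k j / phi (Suc k) i"

lemma weight_nonneg: "i < I \<Longrightarrow> j < I \<Longrightarrow> 0 \<le> weight k i j"
  by (simp add: weight_def A_nonneg phi_nonneg)

lemma weight_row_sum: "i < I \<Longrightarrow> (\<Sum>j<I. weight k i j) = 1"
  using phi_pos[of i "Suc k"] by (simp add: weight_def phi_Suc flip: sum_divide_distrib)

lemma phi_weight: "i < I \<Longrightarrow> phi (Suc k) i * weight k i j = A k i j * phi k j"
  using phi_pos[of i "Suc k"] by (simp add: weight_def)

lemma scaled_sum_eq_weight:
  fixes v :: "nat \<Rightarrow> 'b::real_vector"
  shows "(1 / phi (Suc k) i) *\<^sub>R (\<Sum>j<I. (A k i j * phi k j) *\<^sub>R v j) = (\<Sum>j<I. weight k i j *\<^sub>R v j)"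
  by (simp add: weight_def scaleR_right.sum)

text \<open>The conservation law of push-sum: averaging keeps the \<open>phi\<close>-weighted sum
  because the columns of \<open>A\<close> sum to 1. It governs \<open>z\<close>, the tracked
  gradients and the weighted values of \<open>G\<close>.\<close>

lemma phi_sum_weight:
  fixes v :: "nat \<Rightarrow> 'b::real_vector"
  shows "(\<Sum>i<I. phi (Suc k) i *\<^sub>R (\<Sum>j<I. weight k i j *\<^sub>R v j)) = (\<Sum>j<I. phi k j *\<^sub>R v j)"
proof -
  have "(\<Sum>i<I. phi (Suc k) i *\<^sub>R (\<Sum>j<I. weight k i j *\<^sub>R v j)) = (\<Sum>i<I. \<Sum>j<I. (A k i j * phi k j) *\<^sub>R v j)"
    by (simp add: scaleR_right.sum phi_weight)
  also have "\<dots> = (\<Sum>j<I. \<Sum>i<I. (A k i j * phi k j) *\<^sub>R v j)" by (rule sum.swap)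
  also have "\<dots> = (\<Sum>j<I. phi k j *\<^sub>R v j)"
    by (simp add: A_column_sum flip: scaleR_left.sum sum_distrib_right)
  finally show ?thesis .
qed

text \<open>The sequence is compared with the unperturbed one restarted at time \<open>k\<close>.
  Averaging never amplifies accumulated perturbations, and the unperturbed sequence contracts by the
  Dobrushin bound; two endpoints account for the factor 2.\<close>

lemma perturbed_consensus_contraction:
  fixes v e :: "nat \<Rightarrow> nat \<Rightarrow> 'b::real_normed_vector"
  assumes v: "\<And>k i. i < I \<Longrightarrow> v (Suc k) i = (\<Sum>j<I. weight k i j *\<^sub>R v k j) + e k i"
    and e: "\<And>k i. i < I \<Longrightarrow> norm (e k i) \<le> \<epsilon> k"
  shows "diameter (v (k + window) ` {..<I}) \<le> rate * diameter (v k ` {..<I}) + (\<Sum>t<window. 2 * \<epsilon> (k + t))"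
proof -
  \<comment> \<open>Closed form of the unperturbed sequence: the product of the
    \<open>weight\<close> matrices is the transition matrix rescaled by \<open>phi\<close> at both
    ends.\<close>
  define u where "u n i = (\<Sum>j<I. (transition k n i j * phi k j / phi (k + n) i) *\<^sub>R v k j)" for n i
  have u_0: "u 0 i = v k i" if "i < I" for i
  proof -
    have "u 0 i = (\<Sum>j<I. if j = i then v k j else 0)"
      unfolding u_def using phi_pos[OF that, of k] by (intro sum.cong) auto
    then show ?thesis using that by simp
  qed
  have u_Suc: "u (Suc n) i = (\<Sum>l<I. weight (k + n) i l *\<^sub>R u n l)" if i: "i < I" for n i
  proof -
    have "(\<Sum>l<I. weight (k + n) i l *\<^sub>R u n l)
        = (\<Sum>l<I. \<Sum>j<I. (A (k + n) i l * transition k n l j * (phi k j / phi (k + Suc n) i)) *\<^sub>R v k j)"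
      unfolding u_def weight_def scaleR_right.sum using phi_pos
      by (intro sum.cong refl) (auto simp: less_imp_neq[THEN not_sym])
    also have "\<dots> = u (Suc n) i"
      unfolding u_def by (subst sum.swap) (simp add: sum_distrib_right sum_divide_distrib flip: scaleR_left.sum)
    finally show ?thesis by simp
  qed
  have near: "norm (v (k + n) i - u n i) \<le> (\<Sum>t<n. \<epsilon> (k + t))" if "i < I" for n i
    using that
  proof (induction n arbitrary: i)
    case 0 then show ?case by (simp add: u_0)
  next
    case (Suc n)
    have "v (k + Suc n) i - u (Suc n) i = (\<Sum>l<I. weight (k + n) i l *\<^sub>R (v (k + n) l - u n l)) + e (k + n) i"
      using Suc.prems by (simp add: v u_Suc scaleR_diff_right sum_subtractf)
    moreover have "norm (\<Sum>l<I. weight (k + n) i l *\<^sub>R (v (k + n) l - u n l)) \<le> (\<Sum>t<n. \<epsilon> (k + t))"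
      using Suc weight_nonneg weight_row_sum by (intro norm_convex_combination_le) auto
    ultimately show ?case
      using e[OF Suc.prems, of "k + n"] by (simp add: norm_triangle_le add_mono)
  qed
  define \<eta> where "\<eta> = phi_min\<^sup>2 / real I"
  define p where "p i j = transition k window i j * phi k j / phi (k + window) i" for i j
  have p_sum: "(\<Sum>j<I. p i j) = 1" if "i < I" for i
    using phi_transition[OF that, of k window] phi_pos[OF that, of "k + window"]
    by (simp add: p_def flip: sum_divide_distrib)
  have p_ge: "\<eta> \<le> p i j" if "i < I" "j < I" for i j
    unfolding \<eta>_def p_def power2_eq_square
    using that transition_ge[OF that, of k] phi_ge[of j k] phi_le[of i "k + window"] phi_pos[of i "k + window"] phi_min_pos
    by (intro frac_le mult_mono) (auto simp: phi_min_def window_def transition_nonneg)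
  have u_diff: "norm (u window i - u window j) \<le> rate * diameter (v k ` {..<I})" if "i < I" "j < I" for i j
  proof -
    have "norm ((\<Sum>l<I. p i l *\<^sub>R v k l) - (\<Sum>l<I. p j l *\<^sub>R v k l)) \<le> (1 - real (card {..<I}) * \<eta>) * diameter (v k ` {..<I})"
      using that by (intro norm_diff_convex_combinations_le) (auto simp: p_sum p_ge diameter_image_bound)
    then show ?thesis using I_pos by (simp add: u_def p_def \<eta>_def rate_def)
  qed
  show ?thesis
  proof (rule diameter_le)
    show "v (k + window) ` {..<I} \<noteq> {} \<or> 0 \<le> rate * diameter (v k ` {..<I}) + (\<Sum>t<window. 2 * \<epsilon> (k + t))"
      using I_pos by auto
    fix a b assume "a \<in> v (k + window) ` {..<I}" "b \<in> v (k + window) ` {..<I}"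
    then obtain i j where ij: "i < I" "j < I" "a = v (k + window) i" "b = v (k + window) j" by auto
    have "a - b = (a - u window i) + (u window i - u window j) - (b - u window j)" by simp
    then have "norm (a - b) \<le> norm (a - u window i) + norm (u window i - u window j) + norm (b - u window j)"
      by (metis norm_triangle_ineq norm_triangle_ineq4 add_right_mono order_trans)
    then show "norm (a - b) \<le> rate * diameter (v k ` {..<I}) + (\<Sum>t<window. 2 * \<epsilon> (k + t))"
      using near[OF ij(1), of window] near[OF ij(2), of window] u_diff[OF ij(1,2)] ij
      by (simp flip: sum_distrib_left)
  qed
qed

text \<open>The constant \<open>c\<close> absorbs the initial window and may depend on the run. The
  gain depends on the network only, so a step threshold built from it serves all runs.\<close>

lemma perturbed_consensus_sum_squares:
  fixes v e :: "nat \<Rightarrow> nat \<Rightarrow> 'b::real_normed_vector"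
  assumes v: "\<And>k i. i < I \<Longrightarrow> v (Suc k) i = (\<Sum>j<I. weight k i j *\<^sub>R v k j) + e k i"
    and e: "\<And>k i. i < I \<Longrightarrow> norm (e k i) \<le> \<epsilon> k"
  shows "\<exists>c. \<forall>m. (\<Sum>k<m. (diameter (v k ` {..<I}))\<^sup>2) \<le> c + window_gain * (\<Sum>k<m. (\<epsilon> k)\<^sup>2)"
proof -
  have "0 \<le> \<epsilon> k" for k using e[OF I_pos, of k] norm_ge_zero order_trans by blast
  then have "(\<Sum>k<m. (diameter (v k ` {..<I}))\<^sup>2) \<le> ((\<Sum>k<window. (diameter (v k ` {..<I}))\<^sup>2)
      + (real window)\<^sup>2 / (1 - rate) * (\<Sum>k<m. (2 * \<epsilon> k)\<^sup>2)) / (1 - rate)" for m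
    by (intro sum_squares_of_contraction perturbed_consensus_contraction[OF v e])
      (auto simp: rate diameter_image_nonneg)
  also have "((\<Sum>k<window. (diameter (v k ` {..<I}))\<^sup>2) + (real window)\<^sup>2 / (1 - rate) * (\<Sum>k<m. (2 * \<epsilon> k)\<^sup>2)) / (1 - rate)
      = (\<Sum>k<window. (diameter (v k ` {..<I}))\<^sup>2) / (1 - rate) + window_gain * (\<Sum>k<m. (\<epsilon> k)\<^sup>2)" for m
    by (simp add: window_gain_def power_mult_distrib power2_eq_square add_divide_distrib flip: sum_distrib_left)
  finally show ?thesis by blast
qed

end

section \<open>Convergence of SONATA\<close>

text \<open>Only data fixed before a run enter here, so \<open>step_bound\<close> below cannot
  depend on the steps or the iterates, as the quantifier order of the constant-step claim
  demands.\<close>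

locale sonata_problem = weighted_digraphs +
  fixes X U :: "'a::euclidean_space set"
    and f :: "nat \<Rightarrow> 'a \<Rightarrow> real" and gf :: "nat \<Rightarrow> 'a \<Rightarrow> 'a" and L :: "nat \<Rightarrow> real"
    and G :: "'a \<Rightarrow> real"
    and ft :: "nat \<Rightarrow> 'a \<Rightarrow> 'a \<Rightarrow> real" and gft :: "nat \<Rightarrow> 'a \<Rightarrow> 'a \<Rightarrow> 'a"
    and tau Lt :: "nat \<Rightarrow> real"
  assumes X_ne: "X \<noteq> {}" and X_closed: "closed X" and X_convex: "convex X"
    and U_open: "open U" and XU: "X \<subseteq> U"
    and f_C1: "\<And>i. i < I \<Longrightarrow> C1_grad_on U (f i) (gf i)"
    and f_lip: "\<And>i. i < I \<Longrightarrow> (L i)-lipschitz_on X (gf i)"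
    and G_convex_U: "convex_on U G"
    and V_bdd: "bdd_below ((\<lambda>z. (\<Sum>i<I. f i z) + G z) ` X)"
    and surr_sc: "\<And>i z. i < I \<Longrightarrow> z \<in> X \<Longrightarrow> strongly_convex_on (tau i) X (\<lambda>w. ft i w z)"
    and surr_C1: "\<And>i z. i < I \<Longrightarrow> z \<in> X \<Longrightarrow> C1_grad_on U (\<lambda>w. ft i w z) (\<lambda>w. gft i w z)"
    and surr_grad: "\<And>i z. i < I \<Longrightarrow> z \<in> X \<Longrightarrow> gft i z z = gf i z"
    and surr_lip: "\<And>i w. i < I \<Longrightarrow> w \<in> X \<Longrightarrow> (Lt i)-lipschitz_on X (\<lambda>z. gft i w z)"
begin

text \<open>A sum rather than a maximum, so that one constant serves both each \<open>gf i\<close>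
  and their sum \<open>gF\<close>.\<close>

definition "Lip = (\<Sum>i<I. L i)"
definition "Lipt = (\<Sum>i<I. Lt i)"
definition "\<tau> = Min (tau ` {..<I})"
definition "F z = (\<Sum>i<I. f i z)"
definition "gF z = (\<Sum>i<I. gf i z)"

section \<open>Regularity of the objective and the surrogates\<close>

lemma G_convex: "convex_on X G"
  using convex_on_subset[OF G_convex_U XU X_convex] .

lemma G_continuous: "continuous_on X G"
  using continuous_on_subset[OF convex_on_continuous[OF U_open G_convex_U] XU] .

lemma L_nonneg: "i < I \<Longrightarrow> 0 \<le> L i"
  using f_lip lipschitz_on_nonneg by blast

lemma Lip_nonneg: "0 \<le> Lip"
  unfolding Lip_def by (rule sum_nonneg) (simp add: L_nonneg)

lemma Lt_nonneg: "i < I \<Longrightarrow> 0 \<le> Lt i"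
  using surr_lip lipschitz_on_nonneg X_ne by blast

lemma Lipt_nonneg: "0 \<le> Lipt"
  unfolding Lipt_def by (rule sum_nonneg) (simp add: Lt_nonneg)

lemma gf_lipschitz: "i < I \<Longrightarrow> Lip-lipschitz_on X (gf i)"
  using member_le_sum[of i "{..<I}" L] L_nonneg
  by (auto intro: lipschitz_on_le[OF f_lip] simp: Lip_def)

lemma gft_lipschitz: "i < I \<Longrightarrow> w \<in> X \<Longrightarrow> Lipt-lipschitz_on X (\<lambda>z. gft i w z)"
  using member_le_sum[of i "{..<I}" Lt] Lt_nonneg
  by (auto intro: lipschitz_on_le[OF surr_lip] simp: Lipt_def)

text \<open>Constant \<open>u\<close> gives Lipschitz continuity of \<open>gF\<close>; with
  \<open>u\<close> the local iterates it measures the error of evaluating gradients at disagreeing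
  points.\<close>

lemma gF_gradients_le:
  assumes "\<And>i. i < I \<Longrightarrow> u i \<in> X" "z \<in> X" "\<And>i. i < I \<Longrightarrow> norm (z - u i) \<le> M"
  shows "norm (gF z - (\<Sum>i<I. gf i (u i))) \<le> Lip * M"
proof -
  have "norm (\<Sum>i<I. gf i z - gf i (u i)) \<le> (\<Sum>i<I. L i * M)"
  proof (rule sum_norm_le)
    fix i assume "i \<in> {..<I}"
    then have i: "i < I" by simp
    have "norm (gf i z - gf i (u i)) \<le> L i * norm (z - u i)"
      using lipschitz_onD[OF f_lip[OF i] assms(2) assms(1)[OF i]] by (simp add: dist_norm)
    also have "\<dots> \<le> L i * M" using assms(3)[OF i] L_nonneg[OF i] by (rule mult_left_mono)
    finally show "norm (gf i z - gf i (u i)) \<le> L i * M" .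
  qed
  then show ?thesis by (simp add: gF_def Lip_def sum_subtractf sum_distrib_right)
qed

lemma gF_lipschitz: "Lip-lipschitz_on X gF"
  using gF_gradients_le[of "\<lambda>_. w" z "norm (z - w)" for w z]
  by (intro lipschitz_onI Lip_nonneg) (simp add: dist_norm flip: gF_def)

lemma F_has_derivative: "z \<in> X \<Longrightarrow> (F has_derivative (\<lambda>u. gF z \<bullet> u)) (at z)"
  unfolding F_def[abs_def] gF_def inner_sum_left
  using f_C1 XU by (auto intro!: has_derivative_sum simp: C1_grad_on_def)

lemma \<tau>_pos: "0 < \<tau>"
proof -
  have "0 < tau i" if "i < I" for i using surr_sc[OF that] X_ne by (auto simp: strongly_convex_on_def)
  then show ?thesis unfolding \<tau>_def using I_pos by (subst Min_gr_iff) auto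
qed

lemma \<tau>_le: "i < I \<Longrightarrow> \<tau> \<le> tau i"
  unfolding \<tau>_def by (rule Min_le) auto

lemma surr_has_derivative:
  "i < I \<Longrightarrow> z \<in> X \<Longrightarrow> w \<in> X \<Longrightarrow> ((\<lambda>w. ft i w z) has_derivative (\<lambda>u. gft i w z \<bullet> u)) (at w)"
  using surr_C1 XU by (auto simp: C1_grad_on_def)

text \<open>Lipschitz continuity of the surrogate gradient in its second argument suffices, because both
  gradients may be compared on the diagonal.\<close>

lemma surr_gradient_diff_le:
  assumes "i < I" "z \<in> X" "w \<in> X"
  shows "norm (gft i w z - gf i z) \<le> (Lipt + Lip) * norm (w - z)"
proof -
  have "norm (gft i w z - gft i w w) \<le> Lipt * norm (w - z)"
    using lipschitz_onD[OF gft_lipschitz[OF assms(1,3)] assms(2,3)] by (simp add: dist_norm norm_minus_commute)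
  moreover have "norm (gf i w - gf i z) \<le> Lip * norm (w - z)"
    using lipschitz_onD[OF gf_lipschitz[OF assms(1)] assms(3,2)] by (simp add: dist_norm)
  ultimately show ?thesis
    using norm_triangle_ineq[of "gft i w z - gft i w w" "gf i w - gf i z"] surr_grad[OF assms(1,3)]
    by (simp add: algebra_simps)
qed

text \<open>The prox point moves by at most \<open>1 + Lip\<close> times the shift of the base
  point. This bounds the residual's change per step and carries it from \<open>z\<close> to the
  plain average.\<close>

lemma merit_J_diff_le:
  assumes "z \<in> X" "w \<in> X"
  shows "merit_J I X G gf z \<le> merit_J I X G gf w + (2 + Lip) * norm (z - w)"
proof -
  define p where "p z = prox_point X G (gF z) z" for z
  have min: "minimizer_on X (\<lambda>w. gF z \<bullet> (w - z) + 1/2 * (norm (w - z))\<^sup>2 + G w) (p z)" if "z \<in> X" for z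
    unfolding p_def by (rule prox_point_minimizer[OF X_closed that G_convex G_continuous])
  have "norm (p z - p w) \<le> norm (gF z - gF w) + norm (z - w)"
    by (rule prox_minimizers_dist_le[OF G_convex min[OF assms(1)] min[OF assms(2)]])
  moreover have "norm (gF z - gF w) \<le> Lip * norm (z - w)"
    using lipschitz_onD[OF gF_lipschitz assms] by (simp add: dist_norm)
  moreover have "norm (z - p z) \<le> norm (w - p w) + norm (z - w) + norm (p z - p w)"
    using norm_triangle_ineq[of "w - p w" "z - w"] norm_triangle_ineq4[of "w - p w + (z - w)" "p z - p w"]
    by (simp add: algebra_simps)
  ultimately show ?thesis by (simp add: merit_J_def p_def gF_def algebra_simps)
qed

text \<open>Strong convexity weighted by \<open>phi_min / I\<close>, with a further
  \<open>1 / I\<close> from passing from the sum of squared directions to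
  \<open>(\<delta> k)\<^sup>2\<close>.\<close>

definition "decrease = \<tau> * phi_min / (real I)\<^sup>2"
text \<open>The first summand is the gain of \<open>Dx\<close>; the second is that of
  \<open>Dy\<close>, whose perturbation contains \<open>Dx\<close> itself.\<close>

definition "consensus_gain = window_gain + 2 * window_gain * (Lip / phi_min)\<^sup>2 * (window_gain + 1)"
definition "error_gain = (Lip\<^sup>2 + (real I)\<^sup>2) / decrease"
definition "curvature = Lip + error_gain * consensus_gain"
text \<open>Chosen so that \<open>curvature * \<gamma> k\<close> is at most
  \<open>decrease / 4\<close>, half of what remains after Young's inequality; the \<open>+ 1\<close>
  avoids division by zero.\<close>

definition "step_bound = decrease / (4 * (curvature + 1))"

lemma decrease_pos: "0 < decrease"
  using \<tau>_pos phi_min_pos I_pos by (simp add: decrease_def)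

lemma consensus_gain_nonneg: "0 \<le> consensus_gain"
  using window_gain_nonneg by (simp add: consensus_gain_def)

lemma error_gain_nonneg: "0 \<le> error_gain"
  using decrease_pos by (simp add: error_gain_def)

lemma curvature_nonneg: "0 \<le> curvature"
  using Lip_nonneg consensus_gain_nonneg error_gain_nonneg by (simp add: curvature_def)

lemma step_bound_pos: "0 < step_bound"
  using decrease_pos curvature_nonneg by (simp add: step_bound_def add_nonneg_pos)

end

locale sonata_execution =
  push_sum I E B A \<kappa> phi + sonata_problem I E B A \<kappa> X U f gf L G ft gft tau Lt
  for I :: nat and E B A \<kappa> phi and X U :: "'a::euclidean_space set" and f gf L G ft gft tau Lt +
  fixes \<gamma> :: "nat \<Rightarrow> real" and x xh xt y :: "nat \<Rightarrow> nat \<Rightarrow> 'a"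
  assumes run: "sonata_run I X G gf ft A \<gamma> x xh xt y phi"
    and \<gamma>_pos: "\<And>k. 0 < \<gamma> k" and \<gamma>_le_1: "\<And>k. \<gamma> k \<le> 1"
begin

section \<open>Feasibility of the iterates\<close>

lemma x_0: "i < I \<Longrightarrow> x 0 i \<in> X" and y_0: "i < I \<Longrightarrow> y 0 i = gf i (x 0 i)"
  using run by (simp_all add: sonata_run_def)

lemma xt_minimizer: "i < I \<Longrightarrow> minimizer_on X
    (\<lambda>z. ft i z (x k i) + (real I *\<^sub>R y k i - gf i (x k i)) \<bullet> (z - x k i) + G z) (xt k i)"
  and xh_eq: "i < I \<Longrightarrow> xh k i = x k i + \<gamma> k *\<^sub>R (xt k i - x k i)"
  using run by (simp_all add: sonata_run_def)

lemma x_Suc: "i < I \<Longrightarrow> x (Suc k) i = (\<Sum>j<I. weight k i j *\<^sub>R xh k j)"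
  and y_Suc: "i < I \<Longrightarrow> y (Suc k) i = (\<Sum>j<I. weight k i j *\<^sub>R y k j)
    + (1 / phi (Suc k) i) *\<^sub>R (gf i (x (Suc k) i) - gf i (x k i))"
  using run unfolding sonata_run_def scaled_sum_eq_weight[symmetric] by blast+

lemma xt_in: "i < I \<Longrightarrow> xt k i \<in> X"
  using xt_minimizer by (simp add: minimizer_on_def)

lemma xh_convex_combination: "i < I \<Longrightarrow> xh k i = (1 - \<gamma> k) *\<^sub>R x k i + \<gamma> k *\<^sub>R xt k i"
  by (simp add: xh_eq algebra_simps)

lemma xh_in_if: "i < I \<Longrightarrow> x k i \<in> X \<Longrightarrow> xh k i \<in> X"
  using \<gamma>_pos[of k] \<gamma>_le_1[of k] xt_in X_convex by (auto simp: xh_convex_combination intro!: convexD)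

lemma x_in: "i < I \<Longrightarrow> x k i \<in> X"
proof (induction k arbitrary: i)
  case 0 then show ?case by (rule x_0)
next
  case (Suc k)
  then show ?case
    by (auto simp: x_Suc weight_row_sum weight_nonneg intro!: convex_sum[OF _ X_convex] xh_in_if)
qed

lemma xh_in: "i < I \<Longrightarrow> xh k i \<in> X"
  using xh_in_if x_in by blast

section \<open>Weighted mean and gradient tracking\<close>

definition "d k i = xt k i - x k i"
definition "\<delta> k = (\<Sum>i<I. norm (d k i))"
definition "z k = (\<Sum>i<I. (phi k i / real I) *\<^sub>R x k i)"
definition "Dx k = diameter (x k ` {..<I})"
definition "Dy k = diameter (y k ` {..<I})"

lemma \<delta>_nonneg: "0 \<le> \<delta> k" by (simp add: \<delta>_def sum_nonneg)

lemma Dx_nonneg: "0 \<le> Dx k" and Dy_nonneg: "0 \<le> Dy k"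
  by (simp_all add: Dx_def Dy_def diameter_image_nonneg)

lemma norm_d_le: "i < I \<Longrightarrow> norm (d k i) \<le> \<delta> k"
  unfolding \<delta>_def by (rule member_le_sum) auto

lemma mean_weight: "(\<Sum>i<I. phi k i / real I) = 1" "i < I \<Longrightarrow> 0 \<le> phi k i / real I"
  "i < I \<Longrightarrow> phi k i / real I \<le> 1"
  using I_pos phi_nonneg phi_le by (simp_all add: phi_sum flip: sum_divide_distrib)

lemma z_in: "z k \<in> X"
  unfolding z_def using mean_weight(1,2) x_in by (intro convex_sum[OF _ X_convex]) auto

lemma x_z_le: "i < I \<Longrightarrow> norm (z k - x k i) \<le> Dx k"
  unfolding z_def Dx_def using mean_weight(1,2)
  by (intro norm_diff_convex_combination_le) (auto intro: diameter_image_bound)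

lemma norm_mean_d_le: "norm (\<Sum>i<I. (phi k i / real I) *\<^sub>R d k i) \<le> \<delta> k"
  using mean_weight(1,2) norm_d_le by (intro norm_convex_combination_le) auto

text \<open>Mixing preserves the \<open>phi\<close>-weighted mean, so only the local directions move
  it.\<close>

lemma z_Suc: "z (Suc k) = z k + \<gamma> k *\<^sub>R (\<Sum>i<I. (phi k i / real I) *\<^sub>R d k i)"
proof -
  have "z (Suc k) = (1 / real I) *\<^sub>R (\<Sum>i<I. phi (Suc k) i *\<^sub>R (\<Sum>j<I. weight k i j *\<^sub>R xh k j))"
    unfolding z_def scaleR_right.sum by (simp add: x_Suc scaleR_right.sum)
  also have "\<dots> = (\<Sum>i<I. (phi k i / real I) *\<^sub>R xh k i)"
    unfolding phi_sum_weight by (simp add: scaleR_right.sum)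
  finally show ?thesis
    by (simp add: z_def d_def xh_eq scaleR_add_right sum.distrib scaleR_right.sum mult.commute)
qed

lemma norm_z_Suc_le: "norm (z (Suc k) - z k) \<le> \<gamma> k * \<delta> k"
  using norm_mean_d_le \<gamma>_pos[of k] by (simp add: z_Suc mult_left_mono)

text \<open>The tracking invariant: the factor \<open>1 / phi\<close> in the gradient correction
  cancels against the weight, and the gradient differences telescope.\<close>

lemma y_mean: "(\<Sum>i<I. phi k i *\<^sub>R y k i) = (\<Sum>i<I. gf i (x k i))"
proof (induction k)
  case 0 then show ?case by (simp add: phi_0 y_0)
next
  case (Suc k)
  have "phi (Suc k) i *\<^sub>R y (Suc k) i = phi (Suc k) i *\<^sub>R (\<Sum>j<I. weight k i j *\<^sub>R y k j)
      + (gf i (x (Suc k) i) - gf i (x k i))" if "i < I" for i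
    using that phi_pos[OF that, of "Suc k"] by (simp add: y_Suc scaleR_add_right)
  then have "(\<Sum>i<I. phi (Suc k) i *\<^sub>R y (Suc k) i)
      = (\<Sum>i<I. phi (Suc k) i *\<^sub>R (\<Sum>j<I. weight k i j *\<^sub>R y k j) + (gf i (x (Suc k) i) - gf i (x k i)))"
    by (intro sum.cong) auto
  also have "\<dots> = (\<Sum>i<I. gf i (x (Suc k) i))"
    using Suc by (simp add: sum.distrib phi_sum_weight sum_subtractf)
  finally show ?case .
qed

definition "track k = Lip * Dx k + real I * Dy k"

lemma track_nonneg: "0 \<le> track k"
  by (simp add: track_def Lip_nonneg Dx_nonneg Dy_nonneg)

text \<open>Two errors add up: the disagreement among the \<open>y k i\<close>, scaled by
  \<open>I\<close>, and the evaluation of local gradients at \<open>x k j\<close> instead of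
  \<open>z k\<close>.\<close>

lemma gradient_tracking: assumes i: "i < I" shows "norm (gF (z k) - real I *\<^sub>R y k i) \<le> track k"
proof -
  have "norm ((\<Sum>j<I. (phi k j / real I) *\<^sub>R y k j) - y k i) \<le> Dy k"
    unfolding Dy_def using mean_weight(1,2) i
    by (intro norm_diff_convex_combination_le) (auto intro: diameter_image_bound)
  then have "norm (real I *\<^sub>R ((\<Sum>j<I. (phi k j / real I) *\<^sub>R y k j) - y k i)) \<le> real I * Dy k"
    by (simp add: mult_left_mono)
  moreover have "real I *\<^sub>R ((\<Sum>j<I. (phi k j / real I) *\<^sub>R y k j) - y k i) = (\<Sum>j<I. gf j (x k j)) - real I *\<^sub>R y k i"
    using I_pos by (simp add: scaleR_diff_right scaleR_right.sum flip: y_mean)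
  ultimately have "norm ((\<Sum>j<I. gf j (x k j)) - real I *\<^sub>R y k i) \<le> real I * Dy k"
    by (simp only:)
  moreover have "norm (gF (z k) - (\<Sum>j<I. gf j (x k j))) \<le> Lip * Dx k"
    by (rule gF_gradients_le) (auto simp: x_in z_in x_z_le)
  ultimately show ?thesis
    using norm_triangle_ineq[of "gF (z k) - (\<Sum>j<I. gf j (x k j))" "(\<Sum>j<I. gf j (x k j)) - real I *\<^sub>R y k i"]
    by (simp add: track_def)
qed

section \<open>Consensus errors\<close>

lemma norm_weighted_d_le: "i < I \<Longrightarrow> norm (\<gamma> k *\<^sub>R (\<Sum>j<I. weight k i j *\<^sub>R d k j)) \<le> \<gamma> k * \<delta> k"
  using norm_convex_combination_le[of "{..<I}" "weight k i" "d k" "\<delta> k"] \<gamma>_pos[of k]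
  by (simp add: weight_nonneg weight_row_sum norm_d_le mult_left_mono)

lemma x_recursion:
  "i < I \<Longrightarrow> x (Suc k) i = (\<Sum>j<I. weight k i j *\<^sub>R x k j) + \<gamma> k *\<^sub>R (\<Sum>j<I. weight k i j *\<^sub>R d k j)"
  by (simp add: x_Suc xh_eq d_def scaleR_add_right sum.distrib scaleR_right.sum mult.commute)

lemma x_step_le: assumes i: "i < I" shows "norm (x (Suc k) i - x k i) \<le> Dx k + \<gamma> k * \<delta> k"
proof -
  have "norm ((\<Sum>j<I. weight k i j *\<^sub>R x k j) - x k i) \<le> Dx k"
    unfolding Dx_def using i weight_nonneg weight_row_sum
    by (intro norm_diff_convex_combination_le) (auto intro: diameter_image_bound)
  then show ?thesis
    using norm_triangle_ineq[of "(\<Sum>j<I. weight k i j *\<^sub>R x k j) - x k i" "\<gamma> k *\<^sub>R (\<Sum>j<I. weight k i j *\<^sub>R d k j)"]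
      norm_weighted_d_le[OF i, of k] x_recursion[OF i, of k]
    by (simp add: algebra_simps)
qed

lemma y_perturbation_le:
  assumes i: "i < I"
  shows "norm ((1 / phi (Suc k) i) *\<^sub>R (gf i (x (Suc k) i) - gf i (x k i))) \<le> Lip / phi_min * (Dx k + \<gamma> k * \<delta> k)"
proof -
  have "norm (gf i (x (Suc k) i) - gf i (x k i)) \<le> Lip * norm (x (Suc k) i - x k i)"
    using lipschitz_onD[OF gf_lipschitz[OF i] x_in[OF i] x_in[OF i]] by (simp add: dist_norm)
  also have "\<dots> \<le> Lip * (Dx k + \<gamma> k * \<delta> k)"
    using x_step_le[OF i] Lip_nonneg by (rule mult_left_mono)
  finally have "norm (gf i (x (Suc k) i) - gf i (x k i)) / phi (Suc k) i \<le> Lip * (Dx k + \<gamma> k * \<delta> k) / phi_min"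
    using phi_ge[OF i] phi_min_pos by (intro frac_le) (auto intro: order_trans[OF norm_ge_zero])
  then show ?thesis using phi_pos[OF i, of "Suc k"] by simp
qed

text \<open>The coupling is triangular: \<open>Dx\<close> is driven by
  \<open>\<gamma> k * \<delta> k\<close> alone, \<open>Dy\<close> by this and \<open>Dx\<close>. The
  first bound is therefore inserted into the second without any smallness condition.\<close>

lemma consensus_errors_sum_squares:
  "\<exists>c. \<forall>m. (\<Sum>k<m. (Dx k)\<^sup>2 + (Dy k)\<^sup>2) \<le> c + consensus_gain * (\<Sum>k<m. (\<gamma> k * \<delta> k)\<^sup>2)"
proof -
  define S where "S m = (\<Sum>k<m. (\<gamma> k * \<delta> k)\<^sup>2)" for m
  obtain c where c: "\<And>m. (\<Sum>k<m. (Dx k)\<^sup>2) \<le> c + window_gain * S m"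
    using perturbed_consensus_sum_squares[OF x_recursion norm_weighted_d_le] unfolding Dx_def S_def by blast
  obtain c' where c': "\<And>m. (\<Sum>k<m. (Dy k)\<^sup>2) \<le> c' + window_gain * (\<Sum>k<m. (Lip / phi_min * (Dx k + \<gamma> k * \<delta> k))\<^sup>2)"
    using perturbed_consensus_sum_squares[OF y_Suc y_perturbation_le] unfolding Dy_def by blast
  define a where "a = (Lip / phi_min)\<^sup>2"
  have a: "0 \<le> a" by (simp add: a_def)
  have "(\<Sum>k<m. (Dx k)\<^sup>2 + (Dy k)\<^sup>2) \<le> (c + c' + window_gain * (2 * a * c)) + consensus_gain * S m" for m
  proof -
    have "(\<Sum>k<m. (Lip / phi_min * (Dx k + \<gamma> k * \<delta> k))\<^sup>2) \<le> (\<Sum>k<m. 2 * a * ((Dx k)\<^sup>2 + (\<gamma> k * \<delta> k)\<^sup>2))"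
    proof (rule sum_mono)
      fix k
      have "(Dx k + \<gamma> k * \<delta> k)\<^sup>2 \<le> 2 * ((Dx k)\<^sup>2 + (\<gamma> k * \<delta> k)\<^sup>2)"
        using sum_squares_bound[of "Dx k" "\<gamma> k * \<delta> k"] by (simp add: power2_sum)
      from mult_left_mono[OF this a]
      show "(Lip / phi_min * (Dx k + \<gamma> k * \<delta> k))\<^sup>2 \<le> 2 * a * ((Dx k)\<^sup>2 + (\<gamma> k * \<delta> k)\<^sup>2)"
        by (simp only: a_def power_mult_distrib mult_ac)
    qed
    also have "\<dots> = 2 * a * ((\<Sum>k<m. (Dx k)\<^sup>2) + S m)"
      by (simp add: S_def sum.distrib flip: sum_distrib_left)
    also have "\<dots> \<le> 2 * a * (c + window_gain * S m + S m)"
      using c[of m] a by (intro mult_left_mono) auto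
    finally have "window_gain * (\<Sum>k<m. (Lip / phi_min * (Dx k + \<gamma> k * \<delta> k))\<^sup>2)
        \<le> window_gain * (2 * a * (c + window_gain * S m + S m))"
      using window_gain_nonneg by (rule mult_left_mono)
    then show ?thesis
      using c[of m] c'[of m] by (simp add: consensus_gain_def sum.distrib algebra_simps flip: a_def)
  qed
  then show ?thesis unfolding S_def by blast
qed

section \<open>Descent of the energy\<close>

lemma xt_variational:
  assumes i: "i < I" and w: "w \<in> X"
  shows "0 \<le> (gft i (xt k i) (x k i) - gf i (x k i) + real I *\<^sub>R y k i) \<bullet> (w - xt k i) + G w - G (xt k i)"
proof (rule minimizer_on_variational[OF xt_minimizer[OF i] _ G_convex w])
  show "((\<lambda>z. ft i z (x k i) + (real I *\<^sub>R y k i - gf i (x k i)) \<bullet> (z - x k i)) has_derivative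
      (\<lambda>u. (gft i (xt k i) (x k i) - gf i (x k i) + real I *\<^sub>R y k i) \<bullet> u)) (at (xt k i))"
    using surr_has_derivative[OF i x_in[OF i] xt_in[OF i]]
    by (auto intro!: derivative_eq_intros simp: fun_eq_iff inner_diff_left inner_add_left)
qed

text \<open>The first-order condition of the subproblem is tested at \<open>x k i\<close>. Strong
  monotonicity of the surrogate gradient supplies the quadratic term, and agreement on the diagonal
  cancels \<open>gf i (x k i)\<close>.\<close>

lemma xt_descent:
  assumes i: "i < I"
  shows "(real I *\<^sub>R y k i) \<bullet> d k i + G (xt k i) - G (x k i) \<le> - \<tau> * (norm (d k i))\<^sup>2"
proof -
  note xk = x_in[OF i, of k]
  have "tau i * (norm (d k i))\<^sup>2 \<le> (gft i (xt k i) (x k i) - gft i (x k i) (x k i)) \<bullet> d k i"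
    unfolding d_def
    by (rule strongly_convex_on_gradient_monotone[OF surr_sc[OF i xk] xk xt_in[OF i], where g = "\<lambda>w. gft i w (x k i)"])
      (rule surr_has_derivative[OF i xk])
  moreover have "\<tau> * (norm (d k i))\<^sup>2 \<le> tau i * (norm (d k i))\<^sup>2"
    using \<tau>_le[OF i] by (rule mult_right_mono) simp
  moreover have "x k i - xt k i = - d k i" by (simp add: d_def)
  ultimately show ?thesis
    using xt_variational[OF i xk, of k] surr_grad[OF i xk] by (simp add: inner_diff_left inner_add_left)
qed

text \<open>The mean of the local values of \<open>G\<close> replaces \<open>G (z k)\<close>: it
  does not increase under mixing, it fits the local descent inequalities, and it dominates
  \<open>G (z k)\<close>, so a lower bound of \<open>V\<close> carries over.\<close>

definition "energy k = F (z k) + (\<Sum>i<I. phi k i / real I * G (x k i))"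

lemma energy_bounded_below: "\<exists>b. \<forall>k. b \<le> energy k"
proof -
  obtain b where b: "\<And>z. z \<in> X \<Longrightarrow> b \<le> F z + G z"
    using V_bdd unfolding bdd_below_def F_def by auto
  have "G (z k) \<le> (\<Sum>i<I. phi k i / real I * G (x k i))" for k
    unfolding z_def using mean_weight(1,2) x_in I_pos
    by (intro convex_on_sum[OF _ _ G_convex]) (auto simp: lessThan_empty_iff)
  then show ?thesis using b[OF z_in] unfolding energy_def by (metis add_left_mono order_trans)
qed

text \<open>Jensen's inequality is applied twice, across the mixing step and along each local
  step.\<close>

lemma weighted_G_Suc_le:
  "(\<Sum>i<I. phi (Suc k) i / real I * G (x (Suc k) i))
    \<le> (\<Sum>i<I. phi k i / real I * G (x k i)) + \<gamma> k * (\<Sum>i<I. phi k i / real I * (G (xt k i) - G (x k i)))"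
proof -
  have G_le: "G (x (Suc k) i) \<le> (\<Sum>j<I. weight k i j * G (xh k j))" if "i < I" for i
    unfolding x_Suc[OF that] using that weight_row_sum weight_nonneg xh_in I_pos
    by (intro convex_on_sum[OF _ _ G_convex]) (auto simp: lessThan_empty_iff)
  have "(\<Sum>i<I. phi (Suc k) i / real I * G (x (Suc k) i))
      \<le> (\<Sum>i<I. phi (Suc k) i / real I * (\<Sum>j<I. weight k i j * G (xh k j)))"
    using mean_weight(2) G_le by (intro sum_mono mult_left_mono) auto
  \<comment> \<open>Written with scalar multiplication so that the conservation law
    \<open>phi_sum_weight\<close> applies to the real values of \<open>G\<close>.\<close>
  also have "\<dots> = (\<Sum>i<I. phi (Suc k) i *\<^sub>R (\<Sum>j<I. weight k i j *\<^sub>R G (xh k j))) / real I"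
    by (simp add: sum_divide_distrib)
  also have "\<dots> = (\<Sum>i<I. phi k i / real I * G (xh k i))"
    unfolding phi_sum_weight by (simp add: sum_divide_distrib)
  also have "\<dots> \<le> (\<Sum>i<I. phi k i / real I * ((1 - \<gamma> k) * G (x k i) + \<gamma> k * G (xt k i)))"
  proof (intro sum_mono mult_left_mono)
    fix i assume "i \<in> {..<I}"
    then show "G (xh k i) \<le> (1 - \<gamma> k) * G (x k i) + \<gamma> k * G (xt k i)" "0 \<le> phi k i / real I"
      using convex_onD[OF G_convex, of "\<gamma> k" "x k i" "xt k i"] \<gamma>_pos[of k] \<gamma>_le_1[of k] x_in xt_in mean_weight(2)
      by (simp_all add: xh_convex_combination)
  qed
  also have "\<dots> = (\<Sum>i<I. phi k i / real I * G (x k i)) + \<gamma> k * (\<Sum>i<I. phi k i / real I * (G (xt k i) - G (x k i)))"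
    unfolding sum_distrib_left sum.distrib[symmetric] by (intro sum.cong) (auto simp: algebra_simps)
  finally show ?thesis .
qed

text \<open>Replacing \<open>gF (z k)\<close> by the tracked gradient costs \<open>track k\<close>
  per unit of direction; the rest is the local descent, combined by Cauchy-Schwarz.\<close>

lemma direction_decrease:
  "(\<Sum>i<I. phi k i / real I * (gF (z k) \<bullet> d k i + (G (xt k i) - G (x k i))))
    \<le> track k * \<delta> k - decrease * (\<delta> k)\<^sup>2"
proof -
  have each: "phi k i / real I * (gF (z k) \<bullet> d k i + (G (xt k i) - G (x k i)))
      \<le> track k * norm (d k i) - phi_min / real I * \<tau> * (norm (d k i))\<^sup>2" if i: "i < I" for i
  proof -
    have "(gF (z k) - real I *\<^sub>R y k i) \<bullet> d k i \<le> norm (gF (z k) - real I *\<^sub>R y k i) * norm (d k i)"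
      by (rule norm_cauchy_schwarz)
    also have "\<dots> \<le> track k * norm (d k i)"
      using gradient_tracking[OF i] by (rule mult_right_mono) simp
    finally have "gF (z k) \<bullet> d k i + (G (xt k i) - G (x k i)) \<le> track k * norm (d k i) - \<tau> * (norm (d k i))\<^sup>2"
      using xt_descent[OF i, of k] by (simp add: inner_diff_left)
    then have "phi k i / real I * (gF (z k) \<bullet> d k i + (G (xt k i) - G (x k i)))
        \<le> phi k i / real I * (track k * norm (d k i) - \<tau> * (norm (d k i))\<^sup>2)"
      using mean_weight(2)[OF i] by (rule mult_left_mono)
    moreover have "phi k i / real I * (track k * norm (d k i)) \<le> 1 * (track k * norm (d k i))"
      using mean_weight(3)[OF i] track_nonneg by (intro mult_right_mono) auto
    moreover have "phi_min / real I * (\<tau> * (norm (d k i))\<^sup>2) \<le> phi k i / real I * (\<tau> * (norm (d k i))\<^sup>2)"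
      using phi_ge[OF i] \<tau>_pos by (intro mult_right_mono divide_right_mono) auto
    ultimately show ?thesis by (simp add: right_diff_distrib mult.assoc)
  qed
  have "(\<delta> k)\<^sup>2 \<le> (\<Sum>i<I. (norm (d k i))\<^sup>2) * real I"
    using sum_squared_le_sum_of_squares[of "\<lambda>i. norm (d k i)" "{..<I}"] by (simp add: \<delta>_def)
  then have "phi_min / real I * \<tau> / real I * (\<delta> k)\<^sup>2 \<le> phi_min / real I * \<tau> / real I * ((\<Sum>i<I. (norm (d k i))\<^sup>2) * real I)"
    using phi_min_pos \<tau>_pos by (intro mult_left_mono) auto
  then have "decrease * (\<delta> k)\<^sup>2 \<le> phi_min / real I * \<tau> * (\<Sum>i<I. (norm (d k i))\<^sup>2)"
    using I_pos by (simp add: decrease_def power2_eq_square field_simps)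
  moreover have "(\<Sum>i<I. phi k i / real I * (gF (z k) \<bullet> d k i + (G (xt k i) - G (x k i))))
      \<le> (\<Sum>i<I. track k * norm (d k i) - phi_min / real I * \<tau> * (norm (d k i))\<^sup>2)"
    by (rule sum_mono) (use each in auto)
  moreover have "(\<Sum>i<I. track k * norm (d k i) - phi_min / real I * \<tau> * (norm (d k i))\<^sup>2)
      = track k * \<delta> k - phi_min / real I * \<tau> * (\<Sum>i<I. (norm (d k i))\<^sup>2)"
    by (simp only: \<delta>_def sum_subtractf sum_distrib_left)
  ultimately show ?thesis by linarith
qed

text \<open>Young's inequality weighted so that exactly half of \<open>decrease\<close> is
  spent.\<close>

lemma track_young: "track k * \<delta> k \<le> decrease / 2 * (\<delta> k)\<^sup>2 + error_gain * ((Dx k)\<^sup>2 + (Dy k)\<^sup>2)"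
proof -
  note pos = decrease_pos
  have "0 \<le> (decrease * \<delta> k - track k)\<^sup>2" by simp
  then have "2 * decrease * (track k * \<delta> k) \<le> decrease\<^sup>2 * (\<delta> k)\<^sup>2 + (track k)\<^sup>2"
    by (simp add: power2_diff power_mult_distrib algebra_simps)
  moreover have "(track k)\<^sup>2 \<le> 2 * (Lip\<^sup>2 + (real I)\<^sup>2) * ((Dx k)\<^sup>2 + (Dy k)\<^sup>2)"
  proof -
    have "(track k)\<^sup>2 \<le> 2 * ((Lip * Dx k)\<^sup>2 + (real I * Dy k)\<^sup>2)"
      using sum_squares_bound[of "Lip * Dx k" "real I * Dy k"] by (simp add: track_def power2_sum)
    also have "\<dots> \<le> 2 * ((Lip\<^sup>2 + (real I)\<^sup>2) * ((Dx k)\<^sup>2 + (Dy k)\<^sup>2))"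
      by (simp add: power_mult_distrib algebra_simps)
    finally show ?thesis by (simp only: mult.assoc)
  qed
  moreover have "2 * decrease * (decrease / 2 * (\<delta> k)\<^sup>2 + error_gain * ((Dx k)\<^sup>2 + (Dy k)\<^sup>2))
      = decrease\<^sup>2 * (\<delta> k)\<^sup>2 + 2 * (Lip\<^sup>2 + (real I)\<^sup>2) * ((Dx k)\<^sup>2 + (Dy k)\<^sup>2)"
    using pos by (simp add: error_gain_def power2_eq_square field_simps)
  ultimately have "2 * decrease * (track k * \<delta> k)
      \<le> 2 * decrease * (decrease / 2 * (\<delta> k)\<^sup>2 + error_gain * ((Dx k)\<^sup>2 + (Dy k)\<^sup>2))"
    by linarith
  then show ?thesis using pos by simp
qed

lemma energy_decrease:
  "energy (Suc k) \<le> energy k - decrease / 2 * (\<gamma> k * (\<delta> k)\<^sup>2) + error_gain * ((Dx k)\<^sup>2 + (Dy k)\<^sup>2)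
    + Lip * (\<gamma> k * \<delta> k)\<^sup>2"
proof -
  have "F (z (Suc k)) \<le> F (z k) + gF (z k) \<bullet> (z (Suc k) - z k) + Lip * (norm (z (Suc k) - z k))\<^sup>2"
    by (rule lipschitz_gradient_upper_bound[OF X_convex z_in z_in F_has_derivative gF_lipschitz])
  moreover have "Lip * (norm (z (Suc k) - z k))\<^sup>2 \<le> Lip * (\<gamma> k * \<delta> k)\<^sup>2"
    using norm_z_Suc_le by (intro mult_left_mono power_mono Lip_nonneg) auto
  moreover have "gF (z k) \<bullet> (z (Suc k) - z k) = \<gamma> k * (\<Sum>i<I. phi k i / real I * (gF (z k) \<bullet> d k i))"
    by (simp add: z_Suc inner_sum_right)
  moreover have "(\<Sum>i<I. phi k i / real I * (gF (z k) \<bullet> d k i + (G (xt k i) - G (x k i))))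
      = (\<Sum>i<I. phi k i / real I * (gF (z k) \<bullet> d k i)) + (\<Sum>i<I. phi k i / real I * (G (xt k i) - G (x k i)))"
    by (simp only: distrib_left sum.distrib)
  ultimately have 1: "energy (Suc k) \<le> energy k
      + \<gamma> k * (\<Sum>i<I. phi k i / real I * (gF (z k) \<bullet> d k i + (G (xt k i) - G (x k i)))) + Lip * (\<gamma> k * \<delta> k)\<^sup>2"
    using weighted_G_Suc_le[of k] by (simp add: energy_def distrib_left)
  define err where "err = error_gain * ((Dx k)\<^sup>2 + (Dy k)\<^sup>2)"
  have "(\<Sum>i<I. phi k i / real I * (gF (z k) \<bullet> d k i + (G (xt k i) - G (x k i)))) \<le> err - decrease / 2 * (\<delta> k)\<^sup>2"
    using direction_decrease[of k] track_young[of k] by (simp add: err_def)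
  then have "\<gamma> k * (\<Sum>i<I. phi k i / real I * (gF (z k) \<bullet> d k i + (G (xt k i) - G (x k i))))
      \<le> \<gamma> k * (err - decrease / 2 * (\<delta> k)\<^sup>2)"
    using \<gamma>_pos[of k] by (intro mult_left_mono) auto
  \<comment> \<open>The step factor is dropped here because the consensus bound controls the
    unweighted sum of squares.\<close>
  moreover have "\<gamma> k * err \<le> 1 * err"
    using \<gamma>_le_1[of k] error_gain_nonneg by (intro mult_right_mono) (auto simp: err_def)
  ultimately show ?thesis using 1 by (simp add: err_def algebra_simps)
qed

lemma energy_sum_decrease:
  "energy m \<le> energy 0 - decrease / 2 * (\<Sum>k<m. \<gamma> k * (\<delta> k)\<^sup>2)
    + error_gain * (\<Sum>k<m. (Dx k)\<^sup>2 + (Dy k)\<^sup>2) + Lip * (\<Sum>k<m. (\<gamma> k * \<delta> k)\<^sup>2)"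
proof (induction m)
  case (Suc m)
  then show ?case using energy_decrease[of m] by (simp add: distrib_left)
qed simp

section \<open>Limits under eventually small steps\<close>

context
  assumes small: "eventually (\<lambda>k. \<gamma> k \<le> step_bound) sequentially"
begin

text \<open>In the summed descent the consensus errors are traded for squares of
  \<open>\<gamma> k * \<delta> k\<close>, which a quarter of \<open>decrease\<close> absorbs once
  the steps are small. Boundedness of the energy from below then bounds the partial sums.\<close>

lemma summable_step_energy: "summable (\<lambda>k. \<gamma> k * (\<delta> k)\<^sup>2)"
proof -
  note pos = decrease_pos and cur = curvature_nonneg
  obtain b where b: "\<And>k. b \<le> energy k" using energy_bounded_below by blast
  obtain c where c: "\<And>m. (\<Sum>k<m. (Dx k)\<^sup>2 + (Dy k)\<^sup>2) \<le> c + consensus_gain * (\<Sum>k<m. (\<gamma> k * \<delta> k)\<^sup>2)"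
    using consensus_errors_sum_squares by blast
  obtain N where N: "\<And>k. k \<ge> N \<Longrightarrow> \<gamma> k \<le> step_bound" using small by (auto simp: eventually_sequentially)
  define s where "s k = \<gamma> k * (\<delta> k)\<^sup>2" for k
  have s: "0 \<le> s k" for k using \<gamma>_pos[of k] by (simp add: s_def)
  \<comment> \<open>The unabsorbed part of the quadratic error. It is nonpositive from
    \<open>N\<close> on, so the early steps contribute at most the constant
    \<open>R\<close>.\<close>
  define r where "r k = curvature * (\<gamma> k * \<delta> k)\<^sup>2 - decrease / 4 * s k" for k
  define R where "R = (\<Sum>k<N. \<bar>r k\<bar>)"
  have r: "r k \<le> 0" if "k \<ge> N" for k
  proof -
    have "curvature * \<gamma> k \<le> (curvature + 1) * step_bound"
      using N[OF that] cur \<gamma>_pos[of k] by (intro mult_mono) auto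
    also have "\<dots> = decrease / 4" using cur by (simp add: step_bound_def field_simps)
    finally have "curvature * \<gamma> k * s k \<le> decrease / 4 * s k" using s by (rule mult_right_mono)
    then show ?thesis by (simp add: r_def s_def power2_eq_square algebra_simps)
  qed
  have "(\<Sum>k<m. r k) \<le> R" for m
  proof -
    have "(\<Sum>k<m. r k) \<le> (\<Sum>k<m. if k < N then \<bar>r k\<bar> else 0)"
      by (rule sum_mono) (use r in \<open>auto simp: not_less\<close>)
    also have "\<dots> = (\<Sum>k\<in>{..<m} \<inter> {k. k < N}. \<bar>r k\<bar>)" by (simp add: sum.If_cases)
    also have "\<dots> \<le> R" unfolding R_def by (rule sum_mono2) auto
    finally show ?thesis .
  qed
  moreover have "(\<Sum>k<m. r k) = curvature * (\<Sum>k<m. (\<gamma> k * \<delta> k)\<^sup>2) - decrease / 4 * (\<Sum>k<m. s k)" for m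
    by (simp add: r_def sum_subtractf sum_distrib_left)
  ultimately have R: "curvature * (\<Sum>k<m. (\<gamma> k * \<delta> k)\<^sup>2) \<le> R + decrease / 4 * (\<Sum>k<m. s k)" for m
    by (smt (verit))
  have "(\<Sum>k<m. s k) \<le> (energy 0 - b + error_gain * c + R) / (decrease / 4)" for m
  proof -
    have "b \<le> energy 0 - decrease / 2 * (\<Sum>k<m. s k)
        + error_gain * (\<Sum>k<m. (Dx k)\<^sup>2 + (Dy k)\<^sup>2) + Lip * (\<Sum>k<m. (\<gamma> k * \<delta> k)\<^sup>2)"
      using b[of m] energy_sum_decrease[of m] by (simp add: s_def)
    moreover have "error_gain * (\<Sum>k<m. (Dx k)\<^sup>2 + (Dy k)\<^sup>2)
        \<le> error_gain * (c + consensus_gain * (\<Sum>k<m. (\<gamma> k * \<delta> k)\<^sup>2))"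
      using c error_gain_nonneg by (intro mult_left_mono) auto
    moreover have "error_gain * (c + consensus_gain * (\<Sum>k<m. (\<gamma> k * \<delta> k)\<^sup>2)) + Lip * (\<Sum>k<m. (\<gamma> k * \<delta> k)\<^sup>2)
        = error_gain * c + curvature * (\<Sum>k<m. (\<gamma> k * \<delta> k)\<^sup>2)"
      by (simp add: curvature_def algebra_simps)
    moreover have "decrease / 2 * (\<Sum>k<m. s k) = decrease / 4 * (\<Sum>k<m. s k) + decrease / 4 * (\<Sum>k<m. s k)"
      by simp
    ultimately have "decrease / 4 * (\<Sum>k<m. s k) \<le> energy 0 - b + error_gain * c + R"
      using R[of m] by linarith
    then show ?thesis using pos by (simp add: pos_le_divide_eq mult.commute)
  qed
  then have "summable s" using s by (intro summable_of_partial_sums_le)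
  then show ?thesis by (simp add: s_def[abs_def])
qed

lemma consensus_errors_tendsto_zero: "Dx \<longlonglongrightarrow> 0" "Dy \<longlonglongrightarrow> 0"
proof -
  obtain c where c: "\<And>m. (\<Sum>k<m. (Dx k)\<^sup>2 + (Dy k)\<^sup>2) \<le> c + consensus_gain * (\<Sum>k<m. (\<gamma> k * \<delta> k)\<^sup>2)"
    using consensus_errors_sum_squares by blast
  have "(\<gamma> k * \<delta> k)\<^sup>2 \<le> \<gamma> k * (\<delta> k)\<^sup>2" for k
    using mult_right_mono[OF \<gamma>_le_1[of k], of "\<gamma> k * (\<delta> k)\<^sup>2"] \<gamma>_pos[of k]
    by (simp add: power2_eq_square mult_ac)
  then have "(\<Sum>k<m. (\<gamma> k * \<delta> k)\<^sup>2) \<le> (\<Sum>k<m. \<gamma> k * (\<delta> k)\<^sup>2)" for m by (rule sum_mono)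
  also have "(\<Sum>k<m. \<gamma> k * (\<delta> k)\<^sup>2) \<le> (\<Sum>k. \<gamma> k * (\<delta> k)\<^sup>2)" for m
    by (rule sum_le_suminf[OF summable_step_energy]) (rule finite_lessThan, rule mult_nonneg_nonneg[OF less_imp_le[OF \<gamma>_pos] zero_le_power2])
  finally have "consensus_gain * (\<Sum>k<m. (\<gamma> k * \<delta> k)\<^sup>2) \<le> consensus_gain * (\<Sum>k. \<gamma> k * (\<delta> k)\<^sup>2)" for m
    using consensus_gain_nonneg by (rule mult_left_mono)
  then have "(\<Sum>k<m. (Dx k)\<^sup>2 + (Dy k)\<^sup>2) \<le> c + consensus_gain * (\<Sum>k. \<gamma> k * (\<delta> k)\<^sup>2)" for m
    using c[of m] by (meson add_left_mono order_trans)
  then have "summable (\<lambda>k. (Dx k)\<^sup>2 + (Dy k)\<^sup>2)" by (intro summable_of_partial_sums_le) auto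
  then have lim: "(\<lambda>k. sqrt ((Dx k)\<^sup>2 + (Dy k)\<^sup>2)) \<longlonglongrightarrow> 0"
    using tendsto_real_sqrt[OF summable_LIMSEQ_zero] by fastforce
  show "Dx \<longlonglongrightarrow> 0"
    by (rule tendsto_sandwich[OF _ _ tendsto_const lim]) (auto simp: Dx_nonneg intro!: always_eventually real_le_rsqrt)
  show "Dy \<longlonglongrightarrow> 0"
    by (rule tendsto_sandwich[OF _ _ tendsto_const lim]) (auto simp: Dy_nonneg intro!: always_eventually real_le_rsqrt)
qed

text \<open>The prox point at \<open>z k\<close> is compared with the solution of one agent's
  subproblem; testing both first-order conditions at the other point cancels
  \<open>G\<close>.\<close>

lemma merit_J_z_le:
  "merit_J I X G gf (z k) \<le> (2 + Lipt + Lip) * \<delta> k + (2 * Dx k + track k)"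
proof -
  define p where "p = prox_point X G (gF (z k)) (z k)"
  \<comment> \<open>Agent 0 exists since \<open>I\<close> is positive; its subproblem already sees
    the whole gradient through tracking.\<close>
  define t where "t = xt k 0"
  note i = I_pos
  have min: "minimizer_on X (\<lambda>w. gF (z k) \<bullet> (w - z k) + 1/2 * (norm (w - z k))\<^sup>2 + G w) p"
    unfolding p_def by (rule prox_point_minimizer[OF X_closed z_in G_convex G_continuous])
  then have p: "p \<in> X" by (simp add: minimizer_on_def)
  have t: "t \<in> X" unfolding t_def by (rule xt_in[OF i])
  \<comment> \<open>The gradient of the smooth part of the local subproblem at \<open>t\<close>
    minus that of the prox problem at \<open>t\<close>.\<close>
  define r where "r = (gft 0 t (x k 0) - gf 0 (x k 0)) - (gF (z k) - real I *\<^sub>R y k 0) + (z k - t)"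
  have "0 \<le> (gF (z k) + (p - z k)) \<bullet> (t - p) + G t - G p"
    by (rule minimizer_on_variational[OF min prox_objective_has_derivative G_convex t])
  with xt_variational[OF i p, of k] have "(p - t) \<bullet> (p - t) \<le> r \<bullet> (p - t)"
    unfolding r_def t_def[symmetric] by (simp add: inner_diff inner_add algebra_simps)
  also have "\<dots> \<le> norm r * norm (p - t)" by (rule norm_cauchy_schwarz)
  finally have "norm (p - t) \<le> norm r"
    by (cases "p = t") (auto simp: power2_eq_square simp flip: power2_norm_eq_inner)
  moreover have "norm r \<le> norm (gft 0 t (x k 0) - gf 0 (x k 0)) + norm (gF (z k) - real I *\<^sub>R y k 0) + norm (z k - t)"
    unfolding r_def by (meson norm_triangle_ineq norm_triangle_ineq4 add_right_mono order_trans)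
  moreover have "norm (gft 0 t (x k 0) - gf 0 (x k 0)) \<le> (Lipt + Lip) * norm (d k 0)"
    using surr_gradient_diff_le[OF i x_in[OF i] t] by (simp add: d_def t_def)
  moreover have "norm (z k - t) \<le> Dx k + norm (d k 0)"
    using norm_triangle_ineq4[of "z k - x k 0" "d k 0"] x_z_le[OF i, of k] by (simp add: d_def t_def)
  moreover have "norm (z k - p) \<le> norm (z k - t) + norm (p - t)"
    using norm_triangle_ineq4[of "z k - t" "p - t"] by simp
  ultimately have "norm (z k - p) \<le> (2 + Lipt + Lip) * norm (d k 0) + (2 * Dx k + track k)"
    using gradient_tracking[OF i, of k] by (simp add: distrib_right)
  also have "(2 + Lipt + Lip) * norm (d k 0) \<le> (2 + Lipt + Lip) * \<delta> k"
    using norm_d_le[OF i] Lip_nonneg Lipt_nonneg by (intro mult_left_mono) auto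
  finally show ?thesis by (simp add: merit_J_def p_def gF_def)
qed

text \<open>The residual is first driven to zero at \<open>z k\<close>, where the descent takes
  place, then moved to the plain average, which lies within \<open>Dx k\<close> of it.\<close>

lemma merit_M_tendsto_zero:
  assumes "\<not> summable \<gamma>"
  shows "(\<lambda>k. merit_M I X G gf (x k)) \<longlonglongrightarrow> 0"
proof -
  define J where "J = merit_J I X G gf"
  have J_nonneg: "0 \<le> J w" for w by (simp add: J_def merit_J_def)
  have track: "(\<lambda>k. 2 * Dx k + track k) \<longlonglongrightarrow> 0"
    unfolding track_def using consensus_errors_tendsto_zero by (auto intro!: tendsto_eq_intros)
  have Jz: "(\<lambda>k. J (z k)) \<longlonglongrightarrow> 0"
  proof (rule tendsto_zero_of_controlled_increments[OF \<gamma>_pos \<gamma>_le_1 assms \<delta>_nonneg summable_step_energy])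
    show "J (z k) \<le> (2 + Lipt + Lip) * \<delta> k + (2 * Dx k + track k)" for k
      unfolding J_def by (rule merit_J_z_le)
    fix k
    have "(2 + Lip) * norm (z (Suc k) - z k) \<le> (2 + Lipt + Lip) * (\<gamma> k * \<delta> k)"
      using norm_z_Suc_le Lip_nonneg Lipt_nonneg by (intro mult_mono) auto
    then show "J (z (Suc k)) \<le> J (z k) + (2 + Lipt + Lip) * (\<gamma> k * \<delta> k)"
      using merit_J_diff_le[OF z_in z_in, of "Suc k" k] by (simp add: J_def)
  qed (use J_nonneg track Lip_nonneg Lipt_nonneg in auto)
  have avg_eq: "avg I (x k) = (\<Sum>i<I. (1 / real I) *\<^sub>R x k i)" for k
    by (simp add: avg_def scaleR_right.sum)
  have avg_in: "avg I (x k) \<in> X" for k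
    unfolding avg_eq using I_pos x_in by (intro convex_sum[OF _ X_convex]) auto
  have avg_le: "norm (avg I (x k) - w) \<le> Dx k" if "\<And>i. i < I \<Longrightarrow> norm (x k i - w) \<le> Dx k" for k w
    unfolding avg_eq using I_pos that by (intro norm_diff_convex_combination_le) auto
  have J_avg: "(\<lambda>k. J (avg I (x k))) \<longlonglongrightarrow> 0"
  proof (rule tendsto_sandwich[OF _ _ tendsto_const])
    have "J (avg I (x k)) \<le> J (z k) + (2 + Lip) * Dx k" for k
    proof -
      have "norm (avg I (x k) - z k) \<le> Dx k"
        by (rule avg_le) (use x_z_le in \<open>simp add: norm_minus_commute\<close>)
      then have "(2 + Lip) * norm (avg I (x k) - z k) \<le> (2 + Lip) * Dx k"
        using Lip_nonneg by (intro mult_left_mono) auto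
      then show ?thesis using merit_J_diff_le[OF avg_in z_in, of k k] by (simp add: J_def)
    qed
    then show "\<forall>\<^sub>F k in sequentially. J (avg I (x k)) \<le> J (z k) + (2 + Lip) * Dx k" by simp
    show "(\<lambda>k. J (z k) + (2 + Lip) * Dx k) \<longlonglongrightarrow> 0"
      using Jz consensus_errors_tendsto_zero(1) by (auto intro!: tendsto_eq_intros)
  qed (simp add: J_nonneg)
  have "(\<lambda>k. (merit_D I (x k))\<^sup>2) \<longlonglongrightarrow> 0"
  proof (rule tendsto_sandwich[OF _ _ tendsto_const])
    have "(merit_D I (x k))\<^sup>2 \<le> real I * (Dx k)\<^sup>2" for k
    proof -
      have "norm (x k i - avg I (x k)) \<le> Dx k" if "i < I" for i
        unfolding norm_minus_commute[of "x k i"]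
        by (rule avg_le) (use that in \<open>simp add: Dx_def diameter_image_bound\<close>)
      then have "(\<Sum>i<I. (norm (x k i - avg I (x k)))\<^sup>2) \<le> (\<Sum>i<I. (Dx k)\<^sup>2)"
        by (intro sum_mono power_mono) auto
      then show ?thesis by (simp add: merit_D_def sum_nonneg)
    qed
    then show "\<forall>\<^sub>F k in sequentially. (merit_D I (x k))\<^sup>2 \<le> real I * (Dx k)\<^sup>2" by simp
    show "(\<lambda>k. real I * (Dx k)\<^sup>2) \<longlonglongrightarrow> 0"
      using consensus_errors_tendsto_zero(1) by (auto intro!: tendsto_eq_intros)
  qed simp
  then have "(\<lambda>k. max ((J (avg I (x k)))\<^sup>2) ((merit_D I (x k))\<^sup>2)) \<longlonglongrightarrow> max (0\<^sup>2) 0"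
    using J_avg by (intro tendsto_max tendsto_power)
  then show ?thesis by (simp add: merit_M_def J_def)
qed

end

end

theorem mainTheorem14:
  fixes I :: nat and X U :: "'a::euclidean_space set"
    and f :: "nat \<Rightarrow> 'a \<Rightarrow> real" and gf :: "nat \<Rightarrow> 'a \<Rightarrow> 'a" and L :: "nat \<Rightarrow> real"
    and G :: "'a \<Rightarrow> real"
    and ft :: "nat \<Rightarrow> 'a \<Rightarrow> 'a \<Rightarrow> real" and gft :: "nat \<Rightarrow> 'a \<Rightarrow> 'a \<Rightarrow> 'a"
    and tau Lt :: "nat \<Rightarrow> real"
    and E :: "nat \<Rightarrow> (nat \<times> nat) set" and B :: nat
    and A :: "nat \<Rightarrow> nat \<Rightarrow> nat \<Rightarrow> real" and kappa :: real
  assumes I_pos: "I > 0"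
    and X_ne: "X \<noteq> {}" and X_closed: "closed X" and X_convex: "convex X"
    and O_open: "open U" and XO: "X \<subseteq> U"
    and f_C1: "\<And>i. i < I \<Longrightarrow> C1_grad_on U (f i) (gf i)"
    and f_lip: "\<And>i. i < I \<Longrightarrow> (L i)-lipschitz_on X (gf i)"
    and G_convex: "convex_on U G"
    and V_bdd: "bdd_below ((\<lambda>z. (\<Sum>i<I. f i z) + G z) ` X)"
    and E_nodes: "\<And>k. E k \<subseteq> {..<I} \<times> {..<I}"
    and E_conn: "B_strongly_connected I E B"
    and kappa_pos: "kappa > 0"
    and A_compl: "\<And>k. compliant I (E k) kappa (A k)"
    and A_stoch: "\<And>k. column_stochastic I (A k)"
    and surr_sc: "\<And>i z. i < I \<Longrightarrow> z \<in> X \<Longrightarrow> strongly_convex_on (tau i) X (\<lambda>w. ft i w z)"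
    and surr_C1: "\<And>i z. i < I \<Longrightarrow> z \<in> X \<Longrightarrow> C1_grad_on U (\<lambda>w. ft i w z) (\<lambda>w. gft i w z)"
    and surr_grad: "\<And>i z. i < I \<Longrightarrow> z \<in> X \<Longrightarrow> gft i z z = gf i z"
    and surr_lip: "\<And>i w. i < I \<Longrightarrow> w \<in> X \<Longrightarrow> (Lt i)-lipschitz_on X (\<lambda>z. gft i w z)"
  shows
    "(\<forall>\<gamma> :: nat \<Rightarrow> real.
        (\<forall>k. 0 < \<gamma> k \<and> \<gamma> k \<le> 1) \<and> \<gamma> \<longlonglongrightarrow> 0 \<and> \<not> summable \<gamma> \<longrightarrow>
        (\<forall>x xh xt y phi. sonata_run I X G gf ft A \<gamma> x xh xt y phi \<longrightarrow>
           (\<lambda>k. merit_M I X G gf (x k)) \<longlonglongrightarrow> 0))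
     \<and>
     (\<exists>\<gamma>bar > 0. \<forall>\<gamma>. 0 < \<gamma> \<and> \<gamma> \<le> \<gamma>bar \<longrightarrow>
        (\<forall>x xh xt y phi. sonata_run I X G gf ft A (\<lambda>_. \<gamma>) x xh xt y phi \<longrightarrow>
           (\<lambda>k. merit_M I X G gf (x k)) \<longlonglongrightarrow> 0))"
proof -
  interpret sonata_problem I E B A kappa X U f gf L G ft gft tau Lt
    by unfold_locales (fact assms)+
  have main: "(\<lambda>k. merit_M I X G gf (x k)) \<longlonglongrightarrow> 0"
    if \<gamma>: "\<And>k. 0 < \<gamma> k" "\<And>k. \<gamma> k \<le> 1" "\<forall>\<^sub>F k in sequentially. \<gamma> k \<le> step_bound" "\<not> summable \<gamma>"
      and run: "sonata_run I X G gf ft A \<gamma> x xh xt y phi" for \<gamma> x xh xt y phi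
  proof -
    have phi: "phi 0 i = 1" "phi (Suc k) i = (\<Sum>j<I. A k i j * phi k j)" if "i < I" for i k
      using run that by (simp_all add: sonata_run_def)
    interpret sonata_execution I E B A kappa phi X U f gf L G ft gft tau Lt \<gamma> x xh xt y
      by unfold_locales (fact phi run \<gamma>)+
    show ?thesis by (rule merit_M_tendsto_zero[OF \<gamma>(3,4)])
  qed
  show ?thesis
  \<comment> \<open>The cap 1 keeps each local step a convex combination, so the iterates stay in
    \<open>X\<close>.\<close>
  proof (intro conjI allI impI exI[of _ "min 1 step_bound"])
    fix \<gamma> x xh xt y phi
    assume \<gamma>: "(\<forall>k. 0 < \<gamma> k \<and> \<gamma> k \<le> 1) \<and> \<gamma> \<longlonglongrightarrow> 0 \<and> \<not> summable \<gamma>"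
      and run: "sonata_run I X G gf ft A \<gamma> x xh xt y phi"
    have "\<forall>\<^sub>F k in sequentially. \<gamma> k < step_bound"
      using \<gamma> step_bound_pos by (intro order_tendstoD(2)) auto
    then have "\<forall>\<^sub>F k in sequentially. \<gamma> k \<le> step_bound" by (rule eventually_mono) simp
    then show "(\<lambda>k. merit_M I X G gf (x k)) \<longlonglongrightarrow> 0" using \<gamma> by (intro main[OF _ _ _ _ run]) auto
  next
    show "0 < min 1 step_bound" using step_bound_pos by simp
  next
    fix \<gamma> :: real and x xh xt y phi
    assume "0 < \<gamma> \<and> \<gamma> \<le> min 1 step_bound" and "sonata_run I X G gf ft A (\<lambda>_. \<gamma>) x xh xt y phi"
    then show "(\<lambda>k. merit_M I X G gf (x k)) \<longlonglongrightarrow> 0"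
      by (intro main) (auto simp: summable_const_iff)
  qed
qed

end
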